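(* Let $\mathcal A\in\mathbb R^{n\times n\times p}$ be doubly F-stochastic. Let $f(z)=\sum_{k=0}^\infty c_{2k+1}z^{2k+1}$ be the odd part of an analytic function $g(z)=\sum_{k=0}^\infty c_kz^k$ with $c_{2k+1}\ge0$ for all $k$, the series being convergent for $|z|<R$ with $R>\|\mathcal A\|_2$, and suppose $f(1)=1$. Then $f^{\Diamond}(\mathcal A)$ is also doubly F-stochastic.
   Context: T-product. For $\mathcal A\in\mathbb C^{m\times n\times p}$ with frontal slices $A^{(1)},\dots,A^{(p)}\in\mathbb C^{m\times n}$, $\mathrm{unfold}(\mathcal A)\in\mathbb C^{mp\times n}$ is the vertical stack of $A^{(1)},\dots,A^{(p)}$, $\mathrm{fold}$ is its inverse, and $\mathrm{bcirc}(\mathcal A)\in\mathbb C^{mp\times np}$ is the block circulant matrix whose $(a,b)$ block is $A^{(((a-b)\bmod p)+1)}$; $\mathrm{bcirc}^{-1}$ is the inverse of $\mathrm{bcirc}$ on its image. For $\mathcal B\in\mathbb C^{n\times s\times p}$, $\mathcal A*\mathcal B=\mathrm{fold}(\mathrm{bcirc}(\mathcal A)\,\mathrm{unfold}(\mathcal B))$. $\mathcal A^\top$ (resp. $\mathcal A^H$) is obtained by transposing (resp. conjugate transposing) each frontal slice and reversing the order of slices $2,\dots,p$. The identity tensor has first frontal slice the identity matrix and other slices zero; $\mathcal Q$ is unitary if $\mathcal Q^H*\mathcal Q=\mathcal Q*\mathcal Q^H$ is the identity tensor. The norm is $\|\mathcal A\|_2=\|\mathrm{bcirc}(\mathcal A)\|_2$.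 Doubly F-stochastic: $\mathcal A\in\mathbb R^{n\times n\times p}$ is doubly F-stochastic if and only if $\mathcal A*\mathbf e=\mathcal A^\top*\mathbf e=\mathbf e$, where $\mathbf e\in\mathbb R^{n\times1\times p}$ is the tensor all of whose entries are $1$. Generalized tensor function. $F_p=p^{-1/2}(\omega^{jk})_{j,k=0}^{p-1}$ with $\omega=e^{-2\pi\mathbf i/p}$. A T-SVD is $\mathcal A=\mathcal U*\mathcal S*\mathcal V^H$ with $\mathcal U,\mathcal V$ unitary, $\mathcal S$ F-diagonal (every frontal slice diagonal) and $\mathrm{bcirc}(\mathcal S)=(F_p\otimes I_m)\mathrm{diag}(\Sigma_1,\dots,\Sigma_p)(F_p^H\otimes I_n)$, where each $\Sigma_i\in\mathbb R^{m\times n}$ is diagonal with nonnegative entries. For a scalar function $f$, $f^{\Diamond}(\mathcal A)=\mathcal U*\hat f(\mathcal S)*\mathcal V^H$ with $\hat f(\mathcal S)=\mathrm{bcirc}^{-1}\big((F_p\otimes I_m)\mathrm{diag}(\tilde f(\Sigma_1),\dots,\tilde f(\Sigma_p))(F_p^H\otimes I_n)\big)$ and $\tilde f(\Sigma_i)=f(\sqrt{\Sigma_i\Sigma_i^H})(\sqrt{\Sigma_i\Sigma_i^H})^\dagger\Sigma_i$, i.e. $\tilde f(\Sigma_i)$ is diagonal, with $f(\sigma)$ in place of each diagonal entry $\sigma>0$ and $0$ in place of each diagonal entry $0$. *)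

theory Defs
  imports
    "HOL-Analysis.L2_Norm"
    "Jordan_Normal_Form.Schur_Decomposition"
begin

text \<open>
  A third-order tensor is the list of its frontal slices. Slices are indexed from 0, so the
  slice \<open>A ! k\<close> is the one usually written with the superscript \<open>k + 1\<close>. A real tensor is a
  complex tensor with real entries.
\<close>

type_synonym 'a tensor = "'a mat list"

definition tensors :: "nat \<Rightarrow> nat \<Rightarrow> nat \<Rightarrow> 'a tensor set" where
  "tensors m n p = {A. length A = p \<and> set A \<subseteq> carrier_mat m n}"

definition real_tensor :: "complex tensor \<Rightarrow> bool" where
  "real_tensor A \<longleftrightarrow> (\<forall>M \<in> set A. elements_mat M \<subseteq> \<real>)"

abbreviation nrows :: "'a tensor \<Rightarrow> nat" where
  "nrows A \<equiv> dim_row (hd A)"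

abbreviation ncols :: "'a tensor \<Rightarrow> nat" where
  "ncols A \<equiv> dim_col (hd A)"


section \<open>The T-product\<close>

definition t_unfold :: "'a tensor \<Rightarrow> 'a mat" where
  "t_unfold A = mat (nrows A * length A) (ncols A)
     (\<lambda>(i, j). A ! (i div nrows A) $$ (i mod nrows A, j))"

definition t_fold :: "nat \<Rightarrow> nat \<Rightarrow> 'a mat \<Rightarrow> 'a tensor" where
  "t_fold m p M = map (\<lambda>k. mat m (dim_col M) (\<lambda>(i, j). M $$ (k * m + i, j))) [0..<p]"

text \<open>The offset \<open>length A\<close> keeps the subtraction of block indices from truncating.\<close>

definition bcirc :: "'a tensor \<Rightarrow> 'a mat" where
  "bcirc A = mat (nrows A * length A) (ncols A * length A)
     (\<lambda>(i, j). A ! ((i div nrows A + length A - j div ncols A) mod length A)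
                 $$ (i mod nrows A, j mod ncols A))"

definition bcirc_inv :: "nat \<Rightarrow> nat \<Rightarrow> nat \<Rightarrow> 'a mat \<Rightarrow> 'a tensor" where
  "bcirc_inv m n p = the_inv_into (tensors m n p) bcirc"

definition t_prod :: "'a::semiring_0 tensor \<Rightarrow> 'a tensor \<Rightarrow> 'a tensor" (infixl \<open>*\<^sub>T\<close> 70) where
  "A *\<^sub>T B = t_fold (nrows A) (length A) (bcirc A * t_unfold B)"

definition t_transpose :: "'a tensor \<Rightarrow> 'a tensor" where
  "t_transpose A = map transpose_mat (hd A # rev (tl A))"

definition t_adjoint :: "complex tensor \<Rightarrow> complex tensor" where
  "t_adjoint A = map mat_adjoint (hd A # rev (tl A))"

definition t_id :: "nat \<Rightarrow> nat \<Rightarrow> complex tensor" where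
  "t_id n p = 1\<^sub>m n # replicate (p - 1) (0\<^sub>m n n)"

definition t_unitary :: "nat \<Rightarrow> nat \<Rightarrow> complex tensor \<Rightarrow> bool" where
  "t_unitary n p Q \<longleftrightarrow> Q \<in> tensors n n p \<and>
     t_adjoint Q *\<^sub>T Q = t_id n p \<and> Q *\<^sub>T t_adjoint Q = t_id n p"

definition F_diagonal :: "'a::zero tensor \<Rightarrow> bool" where
  "F_diagonal A \<longleftrightarrow> (\<forall>M \<in> set A. diagonal_mat M)"


section \<open>The spectral norm\<close>

definition norm2_vec :: "complex vec \<Rightarrow> real" where
  "norm2_vec v = L2_set (\<lambda>i. cmod (v $ i)) {..<dim_vec v}"

definition norm2_mat :: "complex mat \<Rightarrow> real" where
  "norm2_mat M = Sup {norm2_vec (M *\<^sub>v v) | v. v \<in> carrier_vec (dim_col M) \<and> norm2_vec v \<le> 1}"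

definition t_norm2 :: "complex tensor \<Rightarrow> real" where
  "t_norm2 A = norm2_mat (bcirc A)"


section \<open>Doubly F-stochastic tensors\<close>

definition t_ones :: "nat \<Rightarrow> nat \<Rightarrow> complex tensor" where
  "t_ones n p = replicate p (mat n 1 (\<lambda>_. 1))"

definition doubly_F_stochastic :: "nat \<Rightarrow> nat \<Rightarrow> complex tensor \<Rightarrow> bool" where
  "doubly_F_stochastic n p A \<longleftrightarrow> A \<in> tensors n n p \<and> real_tensor A \<and>
     A *\<^sub>T t_ones n p = t_ones n p \<and> t_transpose A *\<^sub>T t_ones n p = t_ones n p"


section \<open>Generalized tensor functions\<close>

definition dft_mat :: "nat \<Rightarrow> complex mat" where
  "dft_mat p = mat p p (\<lambda>(j, k). cis (- (2 * pi) / real p) ^ (j * k) / complex_of_real (sqrt (real p)))"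

definition kron :: "'a::times mat \<Rightarrow> 'a mat \<Rightarrow> 'a mat" where
  "kron A B = mat (dim_row A * dim_row B) (dim_col A * dim_col B)
     (\<lambda>(i, j). A $$ (i div dim_row B, j div dim_col B) * B $$ (i mod dim_row B, j mod dim_col B))"

definition undo_dft :: "nat \<Rightarrow> nat \<Rightarrow> complex mat list \<Rightarrow> complex mat" where
  "undo_dft m n Ds = kron (dft_mat (length Ds)) (1\<^sub>m m) * diag_block_mat Ds
     * kron (mat_adjoint (dft_mat (length Ds))) (1\<^sub>m n)"

definition is_tsvd :: "nat \<Rightarrow> nat \<Rightarrow> nat \<Rightarrow> complex tensor \<Rightarrow>
    complex tensor \<Rightarrow> complex tensor \<Rightarrow> real mat list \<Rightarrow> complex tensor \<Rightarrow> bool" where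
  "is_tsvd m n p A U S \<Sigma> V \<longleftrightarrow>
     t_unitary m p U \<and> t_unitary n p V \<and> S \<in> tensors m n p \<and> F_diagonal S \<and>
     length \<Sigma> = p \<and>
     (\<forall>D \<in> set \<Sigma>. D \<in> carrier_mat m n \<and> diagonal_mat D \<and> (\<forall>x \<in> elements_mat D. 0 \<le> x)) \<and>
     bcirc S = undo_dft m n (map (map_mat complex_of_real) \<Sigma>) \<and>
     A = U *\<^sub>T S *\<^sub>T t_adjoint V"

text \<open>For diagonal \<open>D\<close> with nonnegative entries this is \<open>f(sqrt(D D\<^sup>H)) (sqrt(D D\<^sup>H))\<^sup>+ D\<close>, where \<open>\<^sup>+\<close> is the pseudoinverse.\<close>

definition sv_fun :: "(complex \<Rightarrow> complex) \<Rightarrow> real mat \<Rightarrow> complex mat" where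
  "sv_fun f D = mat (dim_row D) (dim_col D)
     (\<lambda>(i, j). if i = j \<and> D $$ (i, j) > 0 then f (complex_of_real (D $$ (i, j))) else 0)"

text \<open>The F-diagonal factor of a T-SVD enters only through its Fourier blocks \<open>\<Sigma>\<close>, which it determines.\<close>

definition F_diagonal_fun :: "(complex \<Rightarrow> complex) \<Rightarrow> nat \<Rightarrow> nat \<Rightarrow> real mat list \<Rightarrow> complex tensor" where
  "F_diagonal_fun f m n \<Sigma> = bcirc_inv m n (length \<Sigma>) (undo_dft m n (map (sv_fun f) \<Sigma>))"

text \<open>
  The value does not depend on the T-SVD, hence the definite description. Using it requires
  that a T-SVD exists and that any two of them give the same value.
\<close>

definition gen_tensor_fun :: "(complex \<Rightarrow> complex) \<Rightarrow> complex tensor \<Rightarrow> complex tensor" where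
  "gen_tensor_fun f A = (THE B. \<exists>U S \<Sigma> V.
     is_tsvd (nrows A) (ncols A) (length A) A U S \<Sigma> V \<and>
     B = U *\<^sub>T F_diagonal_fun f (nrows A) (ncols A) \<Sigma> *\<^sub>T t_adjoint V)"

end

theory Submission
  imports Defs "Jordan_Normal_Form.Spectral_Radius"
begin

text \<open>
  \<open>bcirc\<close> is an injective homomorphism for the T-product that respects adjoints, so a T-SVD of
  \<open>A\<close> becomes a singular value decomposition \<open>M = X D Y\<^sup>H\<close> of the matrix \<open>M = bcirc A\<close>.
  All singular values are at most \<open>t_norm2 A < R\<close>, hence the matrix of the generalized function is
  entrywise the sum of \<open>c\<^sub>2\<^sub>k\<^sub>+\<^sub>1 M (M\<^sup>H M)\<^sup>k\<close>, which does not mention the T-SVD any more. This gives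
  independence of the T-SVD. Moreover, real matrices with all row and column sums equal to 1 are
  closed under products and adjoints, so each \<open>M (M\<^sup>H M)\<^sup>k\<close> is one of them, and the coefficients sum to
  \<open>f 1 = 1\<close> because \<open>1 \<le> t_norm2 A < R\<close>. A T-SVD exists since \<open>bcirc A\<close> is block diagonal in the
  Fourier basis and each block has a singular value decomposition.
\<close>

section \<open>Unitary matrices and the singular value decomposition\<close>

text \<open>A T-SVD is not unique: the diagonal entries of a Fourier block may be permuted, equal
  singular values leave a unitary freedom in the factors, and the singular vectors for the value 0
  can be chosen independently on the two sides. Oddness makes this freedom invisible. In
  \<open>M^H M\<close> the left factor \<open>X\<close> cancels, so \<open>X D^(2k+1) Y^H\<close> is
  a product of copies of \<open>M\<close> and \<open>M^H\<close>, whereas an even power of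
  \<open>D\<close> would bring in the square root of \<open>M^H M\<close>. Oddness also yields
  \<open>f 0 = 0\<close>, in agreement with the convention that a zero singular value is kept at 0.
  Convergence is handled one matrix entry at a time: an entry is a finite combination of scalar
  series, one for each singular value, so no convergence in a matrix norm has to be set up.\<close>

lemma dim_mat_adjoint [simp]:
  "dim_row (mat_adjoint M) = dim_col M" "dim_col (mat_adjoint M) = dim_row M"
  by (simp_all add: mat_adjoint_def)

lemma mat_adjoint_carrier [simp]: "M \<in> carrier_mat n m \<Longrightarrow> mat_adjoint M \<in> carrier_mat m n"
  by (intro carrier_matI) auto

lemma index_mat_adjoint [simp]:
  assumes "i < dim_col M" "j < dim_row M"
  shows "mat_adjoint M $$ (i, j) = conjugate (M $$ (j, i))"
  using assms by (simp add: mat_adjoint_def mat_of_rows_def)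

lemma mat_adjoint_adjoint [simp]: "mat_adjoint (mat_adjoint M) = M"
  by (intro eq_matI) auto

lemma index_mult_mat_sum:
  assumes "A \<in> carrier_mat n m" "B \<in> carrier_mat m k" "i < n" "j < k"
  shows "(A * B) $$ (i, j) = (\<Sum>l<m. A $$ (i, l) * B $$ (l, j))"
  using assms by (simp add: scalar_prod_def lessThan_atLeast0)

lemma mat_adjoint_mult:
  fixes A B :: "'a :: conjugatable_field mat"
  assumes "A \<in> carrier_mat n m" "B \<in> carrier_mat m k"
  shows "mat_adjoint (A * B) = mat_adjoint B * mat_adjoint A"
proof (intro eq_matI)
  fix i j assume "i < dim_row (mat_adjoint B * mat_adjoint A)" "j < dim_col (mat_adjoint B * mat_adjoint A)"
  with assms have i: "i < k" and j: "j < n" by auto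
  have "(mat_adjoint B * mat_adjoint A) $$ (i, j) = (\<Sum>l<m. mat_adjoint B $$ (i, l) * mat_adjoint A $$ (l, j))"
    using assms i j by (intro index_mult_mat_sum) auto
  also have "\<dots> = conjugate ((A * B) $$ (j, i))"
    using assms i j
    by (subst index_mult_mat_sum[OF assms j i])
      (auto simp: sum_conjugate conjugate_dist_mul mult.commute intro!: sum.cong)
  finally show "mat_adjoint (A * B) $$ (i, j) = (mat_adjoint B * mat_adjoint A) $$ (i, j)"
    using assms i j by simp
qed (use assms in auto)

text \<open>One-sided, because for square matrices a left inverse is also a right inverse;
  \<open>unitary_matD\<close> recovers the other equation.\<close>

definition unitary_mat :: "nat \<Rightarrow> complex mat \<Rightarrow> bool" where
  "unitary_mat n U \<longleftrightarrow> U \<in> carrier_mat n n \<and> mat_adjoint U * U = 1\<^sub>m n"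

lemma unitary_matD:
  assumes "unitary_mat n U"
  shows "U \<in> carrier_mat n n" "mat_adjoint U * U = 1\<^sub>m n" "U * mat_adjoint U = 1\<^sub>m n"
  using assms mat_mult_left_right_inverse[of "mat_adjoint U" n U] by (auto simp: unitary_mat_def)

lemma unitary_mat_mult:
  assumes U: "unitary_mat n U" and V: "unitary_mat n V"
  shows "unitary_mat n (U * V)"
proof -
  note c = unitary_matD(1)[OF U] unitary_matD(1)[OF V]
  have "mat_adjoint (U * V) * (U * V) = mat_adjoint V * (mat_adjoint U * U) * V"
    using c by (simp add: mat_adjoint_mult[OF c] assoc_mult_mat[of _ n n _ n _ n] mult_carrier_mat[of _ n n _ n])
  also have "\<dots> = 1\<^sub>m n"
    using c by (simp add: unitary_matD(2)[OF U] unitary_matD(2)[OF V])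
  finally show ?thesis using c by (simp add: unitary_mat_def)
qed

section \<open>The Euclidean norm, its inner product and unitary invariance\<close>

lemma norm2_vec_sq: "complex_of_real ((norm2_vec v)\<^sup>2) = v \<bullet>c v"
proof -
  have "(norm2_vec v)\<^sup>2 = (\<Sum>i<dim_vec v. (cmod (v $ i))\<^sup>2)"
    by (simp add: norm2_vec_def L2_set_def sum_nonneg)
  then show ?thesis
    unfolding scalar_prod_def by (simp add: lessThan_atLeast0 complex_norm_square del: of_real_power)
qed

lemma norm2_vec_nonneg: "0 \<le> norm2_vec v"
  by (simp add: norm2_vec_def)

lemma norm2_vec_eqI:
  assumes "v \<bullet>c v = complex_of_real (a\<^sup>2)" "0 \<le> a"
  shows "norm2_vec v = a"
proof -
  have "(norm2_vec v)\<^sup>2 = a\<^sup>2"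
    using assms(1) norm2_vec_sq[of v] by (metis of_real_eq_iff)
  then show ?thesis
    using assms(2) norm2_vec_nonneg[of v] by simp
qed

lemma norm2_vec_pos:
  assumes "v \<in> carrier_vec n" "v \<noteq> 0\<^sub>v n"
  shows "0 < norm2_vec v"
proof -
  have "v \<bullet>c v \<noteq> 0"
    using assms conjugate_square_eq_0_vec by blast
  then have "norm2_vec v \<noteq> 0"
    using norm2_vec_sq[of v] by (metis of_real_0 power_zero_numeral)
  then show ?thesis using norm2_vec_nonneg[of v] by simp
qed

lemma norm2_vec_smult: "norm2_vec (a \<cdot>\<^sub>v v) = cmod a * norm2_vec v"
  by (simp add: norm2_vec_def L2_set_right_distrib norm_mult cong: L2_set_cong_simp)

lemma mult_mat_vec_cscalar_prod:
  fixes A :: "complex mat"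
  assumes "A \<in> carrier_mat n m" "x \<in> carrier_vec m" "y \<in> carrier_vec n"
  shows "(A *\<^sub>v x) \<bullet>c y = x \<bullet>c (mat_adjoint A *\<^sub>v y)"
proof -
  have "(A *\<^sub>v x) \<bullet>c y = (\<Sum>i<n. \<Sum>j<m. A $$ (i, j) * x $ j * cnj (y $ i))"
    using assms by (simp add: scalar_prod_def lessThan_atLeast0 sum_distrib_right)
  also have "\<dots> = (\<Sum>j<m. \<Sum>i<n. A $$ (i, j) * x $ j * cnj (y $ i))"
    by (rule sum.swap)
  also have "\<dots> = x \<bullet>c (mat_adjoint A *\<^sub>v y)"
    using assms by (simp add: scalar_prod_def lessThan_atLeast0 sum_distrib_left ac_simps)
  finally show ?thesis .
qed

lemma unitary_mat_norm2:
  assumes U: "unitary_mat n U" and v: "v \<in> carrier_vec n"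
  shows "norm2_vec (U *\<^sub>v v) = norm2_vec v"
proof (rule norm2_vec_eqI)
  note c = unitary_matD(1)[OF U]
  have "(U *\<^sub>v v) \<bullet>c (U *\<^sub>v v) = v \<bullet>c ((mat_adjoint U * U) *\<^sub>v v)"
    using c v by (subst mult_mat_vec_cscalar_prod[of _ n n]) (auto simp: assoc_mult_mat_vec[of _ n n _ n])
  then show "(U *\<^sub>v v) \<bullet>c (U *\<^sub>v v) = complex_of_real ((norm2_vec v)\<^sup>2)"
    using v by (simp add: unitary_matD(2)[OF U] norm2_vec_sq del: of_real_power)
qed (rule norm2_vec_nonneg)

text \<open>Complete \<open>v\<close> to a basis and orthogonalize: Gram-Schmidt keeps the first
  vector, and the final normalization of the columns leaves it alone because \<open>v\<close>
  already has norm 1.\<close>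

lemma unitary_mat_completion:
  fixes v :: "complex vec"
  assumes v: "v \<in> carrier_vec n" and v1: "norm2_vec v = 1"
  obtains U where "unitary_mat n U" "col U 0 = v" "0 < n"
proof -
  have v0: "v \<noteq> 0\<^sub>v n"
    using v1 by (auto simp: norm2_vec_def L2_set_def)
  have n: "0 < n"
  proof (rule ccontr)
    assume "\<not> 0 < n"
    then have "v = 0\<^sub>v n" using v by (intro eq_vecI) auto
    with v0 show False ..
  qed
  interpret cof_vec_space n "TYPE(complex)" .
  define b where "b = basis_completion v"
  define ws where "ws = gram_schmidt n b"
  from basis_completion[OF v v0, folded b_def]
  have dist_b: "distinct b" and indep: "\<not> lin_dep (set b)" and b: "set b \<subseteq> carrier_vec n"
    and hdb: "hd b = v" and len_b: "length b = n" by auto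
  from hdb len_b n obtain vs where bv: "b = v # vs" by (cases b) auto
  from gram_schmidt_result[OF b dist_b indep refl, folded ws_def]
  have ws: "set ws \<subseteq> carrier_vec n" "corthogonal ws" "length ws = n"
    by (auto simp: len_b)
  from gram_schmidt_hd[OF v, of vs, folded bv] have hdws: "hd ws = v" unfolding ws_def .
  have ws0: "ws ! 0 = v" using hdws n ws(3) by (cases ws) auto
  have wsc: "ws ! j \<in> carrier_vec n" if "j < n" for j using ws that by auto
  have nz: "norm2_vec (ws ! j) \<noteq> 0" if j: "j < n" for j
  proof -
    have "ws ! j \<bullet>c ws ! j \<noteq> 0" using corthogonalD[OF ws(2)] ws(3) j by auto
    then show ?thesis using norm2_vec_sq[of "ws ! j"] by (metis of_real_0 power_zero_numeral)
  qed
  define U where "U = mat n n (\<lambda>(i, j). ws ! j $ i / complex_of_real (norm2_vec (ws ! j)))"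
  have U: "U \<in> carrier_mat n n" by (simp add: U_def)
  have "mat_adjoint U * U = 1\<^sub>m n"
  proof (intro eq_matI)
    fix i j assume "i < dim_row (1\<^sub>m n :: complex mat)" "j < dim_col (1\<^sub>m n :: complex mat)"
    then have i: "i < n" and j: "j < n" by auto
    have "(mat_adjoint U * U) $$ (i, j) = (\<Sum>l<n. mat_adjoint U $$ (i, l) * U $$ (l, j))"
      using U i j by (intro index_mult_mat_sum) auto
    also have "\<dots> = (\<Sum>l<n. ws ! j $ l * cnj (ws ! i $ l)) /
        complex_of_real (norm2_vec (ws ! i) * norm2_vec (ws ! j))"
      unfolding sum_divide_distrib using U i j by (intro sum.cong) (auto simp: U_def)
    also have "(\<Sum>l<n. ws ! j $ l * cnj (ws ! i $ l)) = ws ! j \<bullet>c ws ! i"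
      using wsc[OF i] wsc[OF j] by (simp add: scalar_prod_def lessThan_atLeast0)
    also have "ws ! j \<bullet>c ws ! i / complex_of_real (norm2_vec (ws ! i) * norm2_vec (ws ! j)) = (if i = j then 1 else 0)"
      using corthogonalD[OF ws(2), of j i] ws(3) i j nz[OF i] norm2_vec_sq[of "ws ! i"]
      by (auto simp: power2_eq_square)
    finally show "(mat_adjoint U * U) $$ (i, j) = 1\<^sub>m n $$ (i, j)" using i j by simp
  qed (use U in auto)
  moreover have "col U 0 = v"
    using n v v1 by (intro eq_vecI) (auto simp: U_def ws0)
  ultimately show ?thesis using that U n unitary_mat_def by blast
qed

text \<open>Induction step of the singular value decomposition: unitary completions of \<open>u\<close> and \<open>v\<close> split
  the singular value \<open>s\<close> off as a \<open>1 \<times> 1\<close> block.\<close>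

lemma exists_singular_vectors:
  fixes A :: "complex mat"
  assumes A: "A \<in> carrier_mat n n" and n: "0 < n"
  obtains u v s t where "u \<in> carrier_vec n" "v \<in> carrier_vec n" "norm2_vec u = 1" "norm2_vec v = 1"
    "0 \<le> s" "A *\<^sub>v v = complex_of_real s \<cdot>\<^sub>v u" "mat_adjoint A *\<^sub>v u = t \<cdot>\<^sub>v v"
proof -
  have normalize: "norm2_vec (complex_of_real (1 / norm2_vec x) \<cdot>\<^sub>v x) = 1"
    if "x \<in> carrier_vec n" "x \<noteq> 0\<^sub>v n" for x
    using norm2_vec_pos[OF that] by (simp only: norm2_vec_smult norm_of_real) simp
  \<comment> \<open>Right singular vectors are eigenvectors of \<open>A^H A\<close>, and over the
    complex numbers one always exists. That the eigenvalue \<open>l\<close> is real need not be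
    known: it enters only the factor \<open>t\<close>.\<close>
  define K where "K = mat_adjoint A * A"
  have K: "K \<in> carrier_mat n n" using A by (simp add: K_def mult_carrier_mat[of _ n n])
  from spectrum_non_empty[OF K n] obtain l v0 where ev: "eigenvector K v0 l"
    by (auto simp: spectrum_def eigenvalue_def)
  have v0: "v0 \<in> carrier_vec n" "v0 \<noteq> 0\<^sub>v n" "K *\<^sub>v v0 = l \<cdot>\<^sub>v v0"
    using ev K by (auto simp: eigenvector_def)
  define v where "v = complex_of_real (1 / norm2_vec v0) \<cdot>\<^sub>v v0"
  have v: "v \<in> carrier_vec n" using v0 by (simp add: v_def)
  have v1: "norm2_vec v = 1" unfolding v_def using normalize v0 by blast
  have Kv: "mat_adjoint A *\<^sub>v (A *\<^sub>v v) = l \<cdot>\<^sub>v v"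
  proof -
    have "mat_adjoint A *\<^sub>v (A *\<^sub>v v) = K *\<^sub>v v"
      using A v by (simp add: K_def assoc_mult_mat_vec[of _ n n _ n])
    also have "\<dots> = l \<cdot>\<^sub>v v"
      using K v0 by (simp add: v_def mult_mat_vec[of _ n n] smult_smult_assoc mult.commute)
    finally show ?thesis .
  qed
  show ?thesis
  proof (cases "A *\<^sub>v v = 0\<^sub>v n")
    \<comment> \<open>The left vector is the normalized image of \<open>v\<close>; then
      \<open>A^H u\<close> is \<open>A^H A v\<close> divided by \<open>s\<close>, again a multiple
      of \<open>v\<close>.\<close>
    case False
    have Av: "A *\<^sub>v v \<in> carrier_vec n" using A v by simp
    define s where "s = norm2_vec (A *\<^sub>v v)"
    define u where "u = complex_of_real (1 / s) \<cdot>\<^sub>v (A *\<^sub>v v)"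
    have s: "0 < s" unfolding s_def using norm2_vec_pos[OF Av False] .
    show ?thesis
    proof (rule that[of u v s "complex_of_real (1 / s) * l"])
      show "u \<in> carrier_vec n" using Av by (simp add: u_def)
      show "norm2_vec u = 1" unfolding u_def s_def using normalize[OF Av False] .
      show "A *\<^sub>v v = complex_of_real s \<cdot>\<^sub>v u" using s by (simp add: u_def smult_smult_assoc)
      show "mat_adjoint A *\<^sub>v u = complex_of_real (1 / s) * l \<cdot>\<^sub>v v"
        using A Av by (simp add: u_def mult_mat_vec[of _ n n] Kv smult_smult_assoc)
    qed (use v v1 s in auto)
  next
    \<comment> \<open>The image of \<open>v\<close> offers no direction for \<open>u\<close>. But
      \<open>A\<close> is singular, hence so is its adjoint, whose determinant is the conjugate one;
      any unit vector in the kernel of the adjoint serves as \<open>u\<close>, with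
      \<open>s = t = 0\<close>.\<close>
    case True
    have "v \<noteq> 0\<^sub>v n" using v1 by (auto simp: norm2_vec_def L2_set_def)
    with True v A have "det A = 0" using det_0_iff_vec_prod_zero by blast
    moreover have "det (mat_adjoint A) = cnj (det A)"
    proof -
      interpret cnj: comm_ring_hom cnj by unfold_locales auto
      have "mat_adjoint A = map_mat cnj (transpose_mat A)" using A by (intro eq_matI) auto
      then show ?thesis using det_transpose[OF A] by (simp add: cnj.hom_det)
    qed
    ultimately have "det (mat_adjoint A) = 0" by simp
    then obtain u0 where u0: "u0 \<in> carrier_vec n" "u0 \<noteq> 0\<^sub>v n" "mat_adjoint A *\<^sub>v u0 = 0\<^sub>v n"
      using det_0_iff_vec_prod_zero[of "mat_adjoint A" n] A by auto
    define u where "u = complex_of_real (1 / norm2_vec u0) \<cdot>\<^sub>v u0"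
    have u: "u \<in> carrier_vec n" using u0 by (simp add: u_def)
    show ?thesis
    proof (rule that[of u v 0 0])
      show "norm2_vec u = 1" unfolding u_def using normalize u0 by blast
      show "A *\<^sub>v v = complex_of_real 0 \<cdot>\<^sub>v u" unfolding True using u by (intro eq_vecI) auto
      show "mat_adjoint A *\<^sub>v u = 0 \<cdot>\<^sub>v v"
        using A u0 v by (simp add: u_def mult_mat_vec[of _ n n]) (auto intro!: eq_vecI)
    qed (use u v v1 in auto)
  qed
qed

lemma unitary_mat_extend:
  assumes U: "unitary_mat n U"
  shows "unitary_mat (Suc n) (four_block_mat (1\<^sub>m 1) (0\<^sub>m 1 n) (0\<^sub>m n 1) U)"
proof -
  note c = unitary_matD(1)[OF U]
  let ?E = "\<lambda>U. four_block_mat (1\<^sub>m 1) (0\<^sub>m 1 n) (0\<^sub>m n 1) (U :: complex mat)"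
  have ad: "mat_adjoint (?E U) = ?E (mat_adjoint U)"
    using c by (intro eq_matI) auto
  have "?E (mat_adjoint U) * ?E U = ?E (mat_adjoint U * U)"
    using c by (subst mult_four_block_mat[of _ 1 1 _ n _ n _ _ 1 _ n]) auto
  also have "\<dots> = 1\<^sub>m (1 + n)"
    using unitary_matD(2)[OF U] four_block_one_mat by metis
  finally show ?thesis using c ad by (auto simp: unitary_mat_def)
qed

theorem singular_value_decomposition:
  fixes A :: "complex mat"
  assumes "A \<in> carrier_mat n n"
  shows "\<exists>U S V. unitary_mat n U \<and> unitary_mat n V \<and> S \<in> carrier_mat n n \<and> diagonal_mat S \<and>
    (\<forall>x \<in> elements_mat S. 0 \<le> x) \<and> A = U * map_mat complex_of_real S * mat_adjoint V"
  using assms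
proof (induction n arbitrary: A)
  case 0
  then show ?case
    by (intro exI[of _ "0\<^sub>m 0 0"] conjI) (auto simp: unitary_mat_def diagonal_mat_def elements_mat_def)
next
  case (Suc n)
  note A = Suc.prems
  obtain u v s t where uv: "u \<in> carrier_vec (Suc n)" "v \<in> carrier_vec (Suc n)" "norm2_vec u = 1"
    "norm2_vec v = 1" and s: "0 \<le> s" and Av: "A *\<^sub>v v = complex_of_real s \<cdot>\<^sub>v u"
    and Au: "mat_adjoint A *\<^sub>v u = t \<cdot>\<^sub>v v"
    using exists_singular_vectors[OF A] by blast
  obtain U1 where U1: "unitary_mat (Suc n) U1" "col U1 0 = u"
    using unitary_mat_completion uv by metis
  obtain V1 where V1: "unitary_mat (Suc n) V1" "col V1 0 = v"
    using unitary_mat_completion uv by metis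
  note c = unitary_matD(1)[OF U1(1)] unitary_matD(1)[OF V1(1)] A
  define C where "C = mat_adjoint U1 * A * V1"
  have C: "C \<in> carrier_mat (Suc n) (Suc n)" using c by (simp add: C_def mult_carrier_mat[of _ "Suc n" "Suc n" _ "Suc n"])
  have C_eq: "C = mat_adjoint U1 * (A * V1)"
    using c by (simp add: C_def assoc_mult_mat[of _ "Suc n" "Suc n" _ "Suc n" _ "Suc n"])
  have AV: "A * V1 \<in> carrier_mat (Suc n) (Suc n)" using c by simp
  \<comment> \<open>The first column of \<open>V1\<close> is \<open>v\<close>, which
    \<open>A\<close> sends to \<open>s\<close> times \<open>u\<close>, and \<open>U1^H\<close> sends
    \<open>u\<close>, the first column of \<open>U1\<close>, to the first unit vector.\<close>
  have col0: "col C 0 = complex_of_real s \<cdot>\<^sub>v unit_vec (Suc n) 0"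
  proof -
    have "col C 0 = mat_adjoint U1 *\<^sub>v col (A * V1) 0"
      using c AV by (simp only: C_eq col_mult2[of _ "Suc n" "Suc n" _ "Suc n"] mat_adjoint_carrier zero_less_Suc)
    also have "col (A * V1) 0 = A *\<^sub>v col V1 0"
      using c by (intro col_mult2[of _ "Suc n" "Suc n" _ "Suc n"]) auto
    finally have "col C 0 = mat_adjoint U1 *\<^sub>v (A *\<^sub>v col V1 0)" .
    also have "\<dots> = complex_of_real s \<cdot>\<^sub>v (mat_adjoint U1 *\<^sub>v col U1 0)"
      using c uv by (simp add: V1 U1 Av mult_mat_vec[of _ "Suc n" "Suc n"])
    also have "mat_adjoint U1 *\<^sub>v col U1 0 = col (mat_adjoint U1 * U1) 0"
      using c by (simp add: col_mult2[of _ "Suc n" "Suc n" _ "Suc n"])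
    finally show ?thesis by (simp add: unitary_matD(2)[OF U1(1)])
  qed
  \<comment> \<open>The first row of \<open>C\<close> is read off the first column of its adjoint:
    \<open>A^H u\<close> is a multiple of \<open>v\<close>, so all entries after the first
    vanish.\<close>
  have row0: "col (mat_adjoint C) 0 = t \<cdot>\<^sub>v unit_vec (Suc n) 0"
  proof -
    have "mat_adjoint C = mat_adjoint V1 * mat_adjoint A * U1"
      using c AV by (simp only: C_eq mat_adjoint_mult[of _ "Suc n" "Suc n" _ "Suc n"] mat_adjoint_carrier
        mat_adjoint_adjoint)
    also have "\<dots> = mat_adjoint V1 * (mat_adjoint A * U1)"
      using c by (simp add: assoc_mult_mat[of _ "Suc n" "Suc n" _ "Suc n" _ "Suc n"])
    finally have "col (mat_adjoint C) 0 = mat_adjoint V1 *\<^sub>v col (mat_adjoint A * U1) 0"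
      using c by (simp only: col_mult2[of _ "Suc n" "Suc n" _ "Suc n"] mat_adjoint_carrier zero_less_Suc
        mult_carrier_mat[of _ "Suc n" "Suc n" _ "Suc n"])
    also have "col (mat_adjoint A * U1) 0 = mat_adjoint A *\<^sub>v col U1 0"
      using c by (intro col_mult2[of _ "Suc n" "Suc n" _ "Suc n"]) auto
    finally have "col (mat_adjoint C) 0 = mat_adjoint V1 *\<^sub>v (mat_adjoint A *\<^sub>v col U1 0)" .
    also have "\<dots> = t \<cdot>\<^sub>v (mat_adjoint V1 *\<^sub>v col V1 0)"
      using c uv by (simp add: V1 U1 Au mult_mat_vec[of _ "Suc n" "Suc n"])
    also have "mat_adjoint V1 *\<^sub>v col V1 0 = col (mat_adjoint V1 * V1) 0"
      using c by (simp add: col_mult2[of _ "Suc n" "Suc n" _ "Suc n"])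
    finally show ?thesis by (simp add: unitary_matD(2)[OF V1(1)])
  qed
  have C0: "C $$ (i, 0) = (if i = 0 then complex_of_real s else 0)" if "i < Suc n" for i
    using arg_cong[OF col0, of "\<lambda>x. x $ i"] that C by (auto simp: unit_vec_def split: if_splits)
  have C0': "C $$ (0, j) = 0" if "0 < j" "j < Suc n" for j
    using arg_cong[OF row0, of "\<lambda>x. x $ j"] that C by (auto simp: unit_vec_def)
  define D where "D = mat n n (\<lambda>(i, j). C $$ (Suc i, Suc j))"
  have D: "D \<in> carrier_mat n n" by (simp add: D_def)
  from Suc.IH[OF D] obtain U2 S V2 where IH: "unitary_mat n U2" "unitary_mat n V2"
    "S \<in> carrier_mat n n" "diagonal_mat S" "\<forall>x \<in> elements_mat S. 0 \<le> x"
    "D = U2 * map_mat complex_of_real S * mat_adjoint V2" by blast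
  define X where "X = (\<lambda>U. four_block_mat (1\<^sub>m 1) (0\<^sub>m 1 n) (0\<^sub>m n 1) (U :: complex mat))"
  define S' where "S' = four_block_mat (mat 1 1 (\<lambda>_. s)) (0\<^sub>m 1 n) (0\<^sub>m n 1) S"
  have S': "S' \<in> carrier_mat (Suc n) (Suc n)" using IH(3) by (auto simp: S'_def)
  have uX: "unitary_mat (Suc n) (X U2)" "unitary_mat (Suc n) (X V2)"
    unfolding X_def by (rule unitary_mat_extend[OF IH(1)], rule unitary_mat_extend[OF IH(2)])
  note c2 = unitary_matD(1)[OF IH(1)] unitary_matD(1)[OF IH(2)]
  have Cblock: "C = X U2 * map_mat complex_of_real S' * mat_adjoint (X V2)"
  proof -
    let ?s = "mat 1 1 (\<lambda>_. complex_of_real s)"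
    have "map_mat complex_of_real S' = four_block_mat ?s (0\<^sub>m 1 n) (0\<^sub>m n 1) (map_mat complex_of_real S)"
      using IH(3) by (intro eq_matI) (auto simp: S'_def)
    then have "X U2 * map_mat complex_of_real S' = four_block_mat ?s (0\<^sub>m 1 n) (0\<^sub>m n 1) (U2 * map_mat complex_of_real S)"
      using c2 IH(3) by (simp add: X_def) (subst mult_four_block_mat[of _ 1 1 _ n _ n _ _ 1 _ n], auto)
    moreover have "mat_adjoint (X V2) = X (mat_adjoint V2)"
      using c2 by (intro eq_matI) (auto simp: X_def)
    ultimately have "X U2 * map_mat complex_of_real S' * mat_adjoint (X V2)
      = four_block_mat ?s (0\<^sub>m 1 n) (0\<^sub>m n 1) D"
      using c2 IH(3,6) by (simp add: X_def) (subst mult_four_block_mat[of _ 1 1 _ n _ n _ _ 1 _ n], auto)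
    also have "\<dots> = C"
      using C by (intro eq_matI) (auto simp: D_def C0 C0')
    finally show ?thesis ..
  qed
  have "U1 * C * mat_adjoint V1 = (U1 * mat_adjoint U1) * A * (V1 * mat_adjoint V1)"
    using c by (simp add: C_def assoc_mult_mat[of _ "Suc n" "Suc n" _ "Suc n" _ "Suc n"]
        mult_carrier_mat[of _ "Suc n" "Suc n" _ "Suc n"])
  also have "\<dots> = A"
    using c by (simp add: unitary_matD(3)[OF U1(1)] unitary_matD(3)[OF V1(1)])
  finally have "A = U1 * X U2 * map_mat complex_of_real S' * mat_adjoint (V1 * X V2)"
    using c S' unitary_matD(1)[OF uX(1)] unitary_matD(1)[OF uX(2)]
    by (simp add: Cblock mat_adjoint_mult[of _ "Suc n" "Suc n" _ "Suc n"]
        assoc_mult_mat[of _ "Suc n" "Suc n" _ "Suc n" _ "Suc n"]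
        mult_carrier_mat[of _ "Suc n" "Suc n" _ "Suc n"])
  moreover have "diagonal_mat S'"
    using IH(3,4) by (auto simp: diagonal_mat_def S'_def)
  moreover have "0 \<le> x" if "x \<in> elements_mat S'" for x
  proof -
    obtain i j where ij: "i < Suc n" "j < Suc n" "x = S' $$ (i, j)"
      using elements_matD[OF \<open>x \<in> elements_mat S'\<close>] S' by auto
    \<comment> \<open>An entry of the lower right block sits in \<open>S\<close> one row and one
      column earlier; the other entries are \<open>s\<close> or 0.\<close>
    then show ?thesis
      using IH(3) s IH(5)[rule_format, OF elements_matI[OF IH(3) _ _ refl, of "i - 1" "j - 1"]]
      by (auto simp: S'_def)
  qed
  ultimately show ?case
    using S' unitary_mat_mult[OF U1(1) uX(1)] unitary_mat_mult[OF V1(1) uX(2)] by blast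
qed

section \<open>Odd power series of a matrix\<close>

text \<open>The diagonal is a function, so that applying \<open>f\<close> or a power to the singular
  values is a composition.\<close>

definition diagonal_of :: "nat \<Rightarrow> (nat \<Rightarrow> complex) \<Rightarrow> complex mat" where
  "diagonal_of n d = mat n n (\<lambda>(i, j). if i = j then d i else 0)"

lemma diagonal_of_carrier [simp]: "diagonal_of n d \<in> carrier_mat n n"
  by (simp add: diagonal_of_def)

lemma diagonal_of_mult: "diagonal_of n d * diagonal_of n e = diagonal_of n (\<lambda>i. d i * e i)"
proof (intro eq_matI)
  fix i j assume "i < dim_row (diagonal_of n (\<lambda>i. d i * e i))" "j < dim_col (diagonal_of n (\<lambda>i. d i * e i))"
  then have ij: "i < n" "j < n" by (auto simp: diagonal_of_def)
  have "(diagonal_of n d * diagonal_of n e) $$ (i, j) =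
    (\<Sum>l<n. diagonal_of n d $$ (i, l) * diagonal_of n e $$ (l, j))"
    using ij by (intro index_mult_mat_sum) auto
  also have "\<dots> = (\<Sum>l<n. if l = i then (if i = j then d i * e i else 0) else 0)"
    using ij by (intro sum.cong) (auto simp: diagonal_of_def)
  finally show "(diagonal_of n d * diagonal_of n e) $$ (i, j) = diagonal_of n (\<lambda>i. d i * e i) $$ (i, j)"
    using ij by (simp add: diagonal_of_def)
qed (simp_all add: diagonal_of_def)

text \<open>Each entry is linear in the diagonal, with finitely many summands; this is the form in
  which a power series can be summed singular value by singular value.\<close>

lemma index_mult_diagonal_of:
  assumes "X \<in> carrier_mat n n" "Y \<in> carrier_mat n n" "i < n" "j < n"
  shows "(X * diagonal_of n d * Y) $$ (i, j) = (\<Sum>l<n. X $$ (i, l) * d l * Y $$ (l, j))"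
proof -
  have "(X * diagonal_of n d) $$ (i, l) = X $$ (i, l) * d l" if "l < n" for l
  proof -
    have "(X * diagonal_of n d) $$ (i, l) = (\<Sum>k<n. X $$ (i, k) * diagonal_of n d $$ (k, l))"
      using assms that by (intro index_mult_mat_sum) auto
    also have "\<dots> = (\<Sum>k<n. if k = l then X $$ (i, l) * d l else 0)"
      using that by (intro sum.cong) (auto simp: diagonal_of_def)
    finally show ?thesis using that by simp
  qed
  then show ?thesis
    using assms by (subst index_mult_mat_sum[of _ n n _ n]) (auto intro!: sum.cong mult_carrier_mat)
qed

fun odd_power :: "complex mat \<Rightarrow> nat \<Rightarrow> complex mat" where
  "odd_power M 0 = M"
| "odd_power M (Suc k) = odd_power M k * (mat_adjoint M * M)"

text \<open>Since \<open>d\<close> is real, \<open>D\<close> is self-adjoint and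
  \<open>M^H M = Y D^2 Y^H\<close>. Each further factor therefore raises the exponent by 2, while
  the unitary factors in between cancel.\<close>

lemma odd_power_singular_values:
  fixes d :: "nat \<Rightarrow> real"
  assumes X: "unitary_mat n X" and Y: "unitary_mat n Y"
    and M: "M = X * diagonal_of n (\<lambda>i. complex_of_real (d i)) * mat_adjoint Y"
  shows "odd_power M k = X * diagonal_of n (\<lambda>i. complex_of_real (d i) ^ (2 * k + 1)) * mat_adjoint Y"
proof (induction k)
  case 0
  show ?case by (simp add: M)
next
  case (Suc k)
  let ?D = "\<lambda>k. diagonal_of n (\<lambda>i. complex_of_real (d i) ^ k)"
  note [simp] = assoc_mult_mat[of _ n n _ n _ n] mult_carrier_mat[of _ n n _ n] mat_adjoint_mult[of _ n n _ n]
  note c = unitary_matD(1)[OF X] unitary_matD(1)[OF Y]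
  have cancel: "mat_adjoint U * (U * Z) = Z" if "unitary_mat n U" "Z \<in> carrier_mat n n" for U Z
  proof -
    have "mat_adjoint U * (U * Z) = (mat_adjoint U * U) * Z"
      using that by (simp add: unitary_matD(1))
    then show ?thesis using that by (simp add: unitary_matD(2))
  qed
  have M1: "M = X * ?D 1 * mat_adjoint Y" by (simp add: M)
  have ad: "mat_adjoint (?D 1) = ?D 1"
    by (intro eq_matI) (auto simp: diagonal_of_def)
  have DD: "?D i * (?D j * Z) = ?D (i + j) * Z" if "Z \<in> carrier_mat n n" for i j Z
    using that by (simp add: diagonal_of_mult power_add flip: assoc_mult_mat[of _ n n _ n _ n])
  have "odd_power M (Suc k) = X * ?D (2 * k + 1) * mat_adjoint Y * (mat_adjoint M * M)"
    by (simp only: odd_power.simps Suc)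
  also have "\<dots> = X * (?D (2 * k + 1) * (mat_adjoint Y * (Y *
      (?D 1 * (mat_adjoint X * (X * (?D 1 * mat_adjoint Y)))))))"
    unfolding M1 using c ad by simp
  also have "\<dots> = X * (?D (2 * k + 1) * (?D 1 * (?D 1 * mat_adjoint Y)))"
    using c cancel[OF X] cancel[OF Y] by simp
  also have "\<dots> = X * (?D (2 * Suc k + 1) * mat_adjoint Y)"
    using c by (simp only: DD mult_carrier_mat[of _ n n _ n] diagonal_of_carrier mat_adjoint_carrier) simp
  finally show ?case using c by simp
qed

section \<open>The spectral norm bounds the singular values, and the series converges on
  them\<close>

text \<open>A supremum of reals is an upper bound only if the set is bounded above. The sum of the
  moduli of all entries is a crude bound that suffices.\<close>

lemma norm2_mat_upper:
  assumes "M \<in> carrier_mat n m" "v \<in> carrier_vec m" "norm2_vec v \<le> 1"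
  shows "norm2_vec (M *\<^sub>v v) \<le> norm2_mat M"
proof -
  have bound: "norm2_vec (M *\<^sub>v w) \<le> (\<Sum>i<n. \<Sum>j<m. cmod (M $$ (i, j)))"
    if w: "w \<in> carrier_vec m" "norm2_vec w \<le> 1" for w
  proof -
    have wj: "cmod (w $ j) \<le> 1" if "j < m" for j
      using that w member_le_L2_set[of "{..<m}" j "\<lambda>j. cmod (w $ j)"] by (simp add: norm2_vec_def)
    have "L2_set (\<lambda>i. cmod ((M *\<^sub>v w) $ i)) {..<n} \<le> (\<Sum>i<n. cmod ((M *\<^sub>v w) $ i))"
      by (intro L2_set_le_sum) auto
    also have "\<dots> \<le> (\<Sum>i<n. \<Sum>j<m. cmod (M $$ (i, j)))"
    proof (rule sum_mono)
      fix i assume "i \<in> {..<n}"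
      then have "cmod ((M *\<^sub>v w) $ i) \<le> (\<Sum>j<m. cmod (M $$ (i, j)) * cmod (w $ j))"
        using assms(1) w by (simp add: scalar_prod_def lessThan_atLeast0 order_trans[OF norm_sum] norm_mult)
      also have "\<dots> \<le> (\<Sum>j<m. cmod (M $$ (i, j)))"
        using wj by (intro sum_mono) (simp add: mult_left_le)
      finally show "cmod ((M *\<^sub>v w) $ i) \<le> (\<Sum>j<m. cmod (M $$ (i, j)))" .
    qed
    finally show ?thesis using assms(1) by (simp add: norm2_vec_def)
  qed
  show ?thesis
    unfolding norm2_mat_def using assms bound
    by (intro cSup_upper bdd_aboveI[of _ "\<Sum>i<n. \<Sum>j<m. cmod (M $$ (i, j))"]) auto
qed

text \<open>Column \<open>i\<close> of \<open>Y\<close> is a unit vector, and \<open>M\<close> sends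
  it to \<open>d i\<close> times column \<open>i\<close> of \<open>X\<close>, a vector of norm
  \<open>d i\<close>.\<close>

lemma singular_value_le_norm2:
  fixes d :: "nat \<Rightarrow> real"
  assumes X: "unitary_mat n X" and Y: "unitary_mat n Y" and i: "i < n" and d: "0 \<le> d i"
    and M: "M = X * diagonal_of n (\<lambda>i. complex_of_real (d i)) * mat_adjoint Y"
  shows "d i \<le> norm2_mat M"
proof -
  let ?e = "unit_vec n i :: complex vec" and ?D = "diagonal_of n (\<lambda>i. complex_of_real (d i))"
  note [simp] = assoc_mult_mat_vec[of _ n n _ n] mult_carrier_mat[of _ n n _ n] mult_mat_vec_carrier[of _ n n]
  note c = unitary_matD(1)[OF X] unitary_matD(1)[OF Y]
  have ne: "norm2_vec ?e = 1"
    using i by (intro norm2_vec_eqI) auto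
  have "mat_adjoint Y *\<^sub>v (Y *\<^sub>v ?e) = ?e"
    using c by (simp add: unitary_matD(2)[OF Y] flip: assoc_mult_mat_vec[of _ n n _ n])
  then have "M *\<^sub>v (Y *\<^sub>v ?e) = X *\<^sub>v (?D *\<^sub>v ?e)"
    using c by (simp add: M)
  also have "?D *\<^sub>v ?e = complex_of_real (d i) \<cdot>\<^sub>v ?e"
    using i by (intro eq_vecI) (auto simp: diagonal_of_def)
  finally have "norm2_vec (M *\<^sub>v (Y *\<^sub>v ?e)) = d i"
    using i d ne by (simp add: unitary_mat_norm2[OF X] norm2_vec_smult)
  moreover have "norm2_vec (M *\<^sub>v (Y *\<^sub>v ?e)) \<le> norm2_mat M"
    using c ne by (intro norm2_mat_upper[of _ n n]) (auto simp: M unitary_mat_norm2[OF Y])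
  ultimately show ?thesis by simp
qed

text \<open>All \<open>d l\<close> lie in the disc of convergence, being at most
  \<open>norm2_mat M < R\<close>. So the series for \<open>f\<close> can be evaluated at each of
  them, and the finite sum over \<open>l\<close> commutes with the infinite one over
  \<open>k\<close>.\<close>

lemma odd_power_series_sums:
  fixes d :: "nat \<Rightarrow> real"
  assumes X: "unitary_mat n X" and Y: "unitary_mat n Y" and d: "\<And>i. i < n \<Longrightarrow> 0 \<le> d i"
    and M: "M = X * diagonal_of n (\<lambda>i. complex_of_real (d i)) * mat_adjoint Y"
    and f: "\<And>z. cmod z < R \<Longrightarrow> (\<lambda>k. c (2 * k + 1) * z ^ (2 * k + 1)) sums f z"
    and R: "norm2_mat M < R"
    and ij: "i < n" "j < n"
  shows "(\<lambda>k. c (2 * k + 1) * odd_power M k $$ (i, j)) sums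
    (X * diagonal_of n (\<lambda>i. f (complex_of_real (d i))) * mat_adjoint Y) $$ (i, j)"
proof -
  have summand: "c (2 * k + 1) * odd_power M k $$ (i, j) =
      (\<Sum>l<n. X $$ (i, l) * (c (2 * k + 1) * complex_of_real (d l) ^ (2 * k + 1)) * mat_adjoint Y $$ (l, j))" for k
    using unitary_matD(1)[OF X] unitary_matD(1)[OF Y] ij
    by (simp only: odd_power_singular_values[OF X Y M] index_mult_diagonal_of mat_adjoint_carrier sum_distrib_left)
      (simp add: mult.assoc mult.left_commute)
  have "cmod (complex_of_real (d l)) < R" if "l < n" for l
    using singular_value_le_norm2[OF X Y that d M] that d R by simp
  then have "(\<lambda>k. \<Sum>l<n. X $$ (i, l) * (c (2 * k + 1) * complex_of_real (d l) ^ (2 * k + 1)) * mat_adjoint Y $$ (l, j))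
    sums (\<Sum>l<n. X $$ (i, l) * f (complex_of_real (d l)) * mat_adjoint Y $$ (l, j))"
    by (intro sums_sum sums_mult sums_mult2 f) auto
  then show ?thesis
    unfolding summand using unitary_matD(1)[OF X] unitary_matD(1)[OF Y] ij by (subst index_mult_diagonal_of) simp_all
qed

section \<open>Block circulant matrices\<close>

text \<open>The slice number in block row \<open>x\<close> and block column \<open>y\<close> of
  \<open>bcirc\<close>. The laws below are proved in the integers modulo \<open>p\<close>, where no
  truncated subtraction interferes.\<close>

definition cyclic_diff :: "nat \<Rightarrow> nat \<Rightarrow> nat \<Rightarrow> nat" where
  "cyclic_diff p x y = (x + p - y) mod p"

lemma int_cyclic_diff: "y \<le> p \<Longrightarrow> int (cyclic_diff p x y) = (int x - int y) mod int p"
proof -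
  assume "y \<le> p"
  then have "int (cyclic_diff p x y) = (int x - int y + int p) mod int p"
    by (simp add: cyclic_diff_def of_nat_diff zmod_int algebra_simps)
  then show ?thesis by simp
qed

lemma cyclic_diff_less [simp]: "0 < p \<Longrightarrow> cyclic_diff p x y < p"
  by (simp add: cyclic_diff_def)

lemma cyclic_diff_zero [simp]: "x < p \<Longrightarrow> cyclic_diff p x 0 = x"
  by (simp add: cyclic_diff_def)

lemma cyclic_diff_eq_0_iff [simp]:
  assumes "x < p" "y < p"
  shows "cyclic_diff p x y = 0 \<longleftrightarrow> x = y"
proof -
  have "cyclic_diff p x y = 0 \<longleftrightarrow> int x mod int p = int y mod int p"
    using int_cyclic_diff[of y p x] assms
    by (metis less_imp_le mod_eq_dvd_iff mod_eq_0_iff_dvd of_nat_eq_0_iff)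
  then show ?thesis using assms by simp
qed

text \<open>Invariance under a common shift, the reason why products of block circulant matrices are
  block circulant.\<close>

lemma cyclic_diff_cancel:
  assumes "x < p" "y < p" "z < p"
  shows "cyclic_diff p (cyclic_diff p x z) (cyclic_diff p y z) = cyclic_diff p x y"
proof -
  have "cyclic_diff p y z \<le> p" using assms by (simp add: less_imp_le)
  then have "int (cyclic_diff p (cyclic_diff p x z) (cyclic_diff p y z)) = int (cyclic_diff p x y)"
    using assms by (simp add: int_cyclic_diff mod_simps)
  then show ?thesis by simp
qed

lemma cyclic_diff_swap:
  assumes "x < p" "y < p"
  shows "cyclic_diff p 0 (cyclic_diff p x y) = cyclic_diff p y x"
proof -
  have "cyclic_diff p x y \<le> p" using assms by (simp add: less_imp_le)
  then have "int (cyclic_diff p 0 (cyclic_diff p x y)) = int (cyclic_diff p y x)"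
    using assms by (simp add: int_cyclic_diff mod_simps)
  then show ?thesis by simp
qed

text \<open>A cyclic shift is an injective map of a finite set into itself, hence a permutation of
  the summation range.\<close>

lemma sum_cyclic_diff:
  assumes "z < p"
  shows "(\<Sum>x<p. h (cyclic_diff p x z)) = (\<Sum>x<p. h x)"
proof (rule sum.reindex_bij_betw)
  have "inj_on (\<lambda>x. cyclic_diff p x z) {..<p}"
  proof (rule inj_onI)
    fix x y assume "x \<in> {..<p}" "y \<in> {..<p}" "cyclic_diff p x z = cyclic_diff p y z"
    then show "x = y"
      using assms cyclic_diff_cancel[of x p y z] cyclic_diff_eq_0_iff[of x p y]
        cyclic_diff_eq_0_iff[of "cyclic_diff p x z" p "cyclic_diff p y z"] by auto
  qed
  moreover have "(\<lambda>x. cyclic_diff p x z) ` {..<p} \<subseteq> {..<p}" using assms by auto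
  ultimately show "bij_betw (\<lambda>x. cyclic_diff p x z) {..<p} {..<p}"
    by (simp add: bij_betw_def endo_inj_surj)
qed

section \<open>Splitting an index into block number and offset\<close>

lemma sum_blocks: "(\<Sum>i<n * p. h i) = (\<Sum>a<p. \<Sum>b<n. h (a * n + b))" for n p :: nat
proof -
  have "(\<Sum>a<p. \<Sum>b<n. h (a * n + b)) = (\<Sum>a<p. sum h {a * n..<a * n + n})"
  proof (rule sum.cong[OF refl])
    fix a
    show "(\<Sum>b<n. h (a * n + b)) = sum h {a * n..<a * n + n}"
      using sum.shift_bounds_nat_ivl[of h 0 "a * n" n] by (simp add: add.commute lessThan_atLeast0)
  qed
  then show ?thesis by (simp add: sum.nat_group mult.commute)
qed

lemma block_div_less: "i < n * p \<Longrightarrow> i div n < p" for i n p :: nat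
  by (simp add: less_mult_imp_div_less mult.commute)

lemma block_mod_less: "i < n * p \<Longrightarrow> i mod n < n" for i n p :: nat
  by (cases n) auto

lemma block_index_less: "\<lbrakk>a < p; b < n\<rbrakk> \<Longrightarrow> a * n + b < n * p" for a b n p :: nat
proof -
  assume "a < p" "b < n"
  then have "a * n + b < Suc a * n" by simp
  also have "\<dots> \<le> p * n" using \<open>a < p\<close> by (intro mult_le_mono1) simp
  finally show ?thesis by (simp add: mult.commute)
qed

lemma block_index_eq: "i div n = j div n \<Longrightarrow> i mod n = j mod n \<Longrightarrow> i = j" for i j n :: nat
  by (metis div_mult_mod_eq)

section \<open>Tensors and the T-product in terms of \<open>bcirc\<close>\<close>

lemma tensorsD:
  assumes "A \<in> tensors m n p"
  shows "length A = p" "k < p \<Longrightarrow> A ! k \<in> carrier_mat m n"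
  using assms by (auto simp: tensors_def)

lemma tensors_dims:
  assumes "A \<in> tensors m n p" "0 < p"
  shows "nrows A = m" "ncols A = n"
  using tensorsD(1)[OF assms(1)] tensorsD(2)[OF assms] assms(2) by (auto simp: hd_conv_nth)

lemma tensors_eqI:
  assumes "A \<in> tensors m n p" "B \<in> tensors m n p"
    and "\<And>k i j. k < p \<Longrightarrow> i < m \<Longrightarrow> j < n \<Longrightarrow> A ! k $$ (i, j) = B ! k $$ (i, j)"
  shows "A = B"
proof (intro nth_equalityI)
  show "length A = length B" using assms(1,2) by (simp add: tensorsD(1))
  fix k assume "k < length A"
  then have k: "k < p" using assms(1) by (simp add: tensorsD(1))
  show "A ! k = B ! k"
    using tensorsD(2)[OF assms(1) k] tensorsD(2)[OF assms(2) k] assms(3)[OF k] by (intro eq_matI) auto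
qed

lemma bcirc_carrier: "A \<in> tensors m n p \<Longrightarrow> 0 < p \<Longrightarrow> bcirc A \<in> carrier_mat (m * p) (n * p)"
  by (simp add: bcirc_def tensors_dims tensorsD(1))

lemma index_bcirc:
  assumes "A \<in> tensors m n p" "i < m * p" "j < n * p"
  shows "bcirc A $$ (i, j) = A ! cyclic_diff p (i div m) (j div n) $$ (i mod m, j mod n)"
proof -
  have "0 < p" using assms(2) by (cases p) auto
  then show ?thesis
    using assms by (simp add: bcirc_def tensors_dims tensorsD(1) cyclic_diff_def)
qed

text \<open>The first block column of \<open>bcirc A\<close> is the stack of the slices, so the
  matrix determines the tensor.\<close>

lemma nth_index_bcirc:
  assumes "A \<in> tensors m n p" "k < p" "r < m" "s < n"
  shows "A ! k $$ (r, s) = bcirc A $$ (k * m + r, s)"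
proof -
  have "0 < p" using assms(2) by simp
  then have "s < n * p" using assms(4) by (simp add: less_le_trans)
  then show ?thesis using assms by (subst index_bcirc[OF assms(1)]) (auto simp: block_index_less)
qed

lemma inj_on_bcirc: "inj_on bcirc (tensors m n p)"
proof (rule inj_onI)
  fix A B assume AB: "A \<in> tensors m n p" "B \<in> tensors m n p" and eq: "bcirc A = bcirc B"
  show "A = B"
    using AB by (rule tensors_eqI) (simp add: nth_index_bcirc[OF AB(1)] nth_index_bcirc[OF AB(2)] eq)
qed

lemma t_prod_tensors:
  assumes "A \<in> tensors m n p" "B \<in> tensors n k p" "0 < p"
  shows "A *\<^sub>T B \<in> tensors m k p"
  using assms by (auto simp: t_prod_def tensors_def t_fold_def t_unfold_def tensors_dims[OF assms(2,3)] tensors_dims[OF assms(1,3)])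

lemma index_t_prod:
  assumes A: "A \<in> tensors m n p" and B: "B \<in> tensors n k p" and l: "l < p" "r < m" "s < k"
  shows "(A *\<^sub>T B) ! l $$ (r, s) =
    (\<Sum>a<p. \<Sum>b<n. A ! cyclic_diff p l a $$ (r, b) * B ! a $$ (b, s))"
proof -
  have p: "0 < p" using l by simp
  note d = tensors_dims[OF A p] tensors_dims[OF B p] tensorsD(1)[OF A] tensorsD(1)[OF B]
  have U: "t_unfold B \<in> carrier_mat (n * p) k" by (simp add: t_unfold_def d)
  have i: "l * m + r < m * p" using l by (simp add: block_index_less)
  have "(A *\<^sub>T B) ! l $$ (r, s) = (bcirc A * t_unfold B) $$ (l * m + r, s)"
    using l U by (simp add: t_prod_def t_fold_def d)
  also have "\<dots> = (\<Sum>j<n * p. bcirc A $$ (l * m + r, j) * t_unfold B $$ (j, s))"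
    using i l U bcirc_carrier[OF A p] by (intro index_mult_mat_sum)
  also have "\<dots> = (\<Sum>a<p. \<Sum>b<n. A ! cyclic_diff p l a $$ (r, b) * B ! a $$ (b, s))"
    unfolding sum_blocks using l
    by (intro sum.cong refl) (auto simp: index_bcirc[OF A] i block_index_less t_unfold_def d)
  finally show ?thesis .
qed

lemma bcirc_t_prod:
  assumes A: "A \<in> tensors m n p" and B: "B \<in> tensors n k p" and p: "0 < p"
  shows "bcirc (A *\<^sub>T B) = bcirc A * bcirc B"
proof (intro eq_matI)
  note AB = t_prod_tensors[OF A B p]
  note c = bcirc_carrier[OF A p] bcirc_carrier[OF B p] bcirc_carrier[OF AB p]
  fix i j assume "i < dim_row (bcirc A * bcirc B)" "j < dim_col (bcirc A * bcirc B)"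
  then have ij: "i < m * p" "j < k * p" using c by auto
  note lt = block_div_less[OF ij(1)] block_div_less[OF ij(2)] block_mod_less[OF ij(1)] block_mod_less[OF ij(2)]
  let ?d = "cyclic_diff p (i div m) (j div k)"
  let ?h = "\<lambda>a. \<Sum>b<n. A ! cyclic_diff p ?d a $$ (i mod m, b) * B ! a $$ (b, j mod k)"
  have "(bcirc A * bcirc B) $$ (i, j) = (\<Sum>l<n * p. bcirc A $$ (i, l) * bcirc B $$ (l, j))"
    using c ij by (intro index_mult_mat_sum)
  \<comment> \<open>Shifting all block indices by the block column \<open>j div k\<close> changes no
    slice number, by \<open>cyclic_diff_cancel\<close>; afterwards the shift is absorbed by the
    summation over \<open>a\<close>.\<close>
  also have "\<dots> = (\<Sum>a<p. ?h (cyclic_diff p a (j div k)))"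
    unfolding sum_blocks using lt ij
    by (intro sum.cong refl) (auto simp: index_bcirc[OF A] index_bcirc[OF B] block_index_less cyclic_diff_cancel)
  also have "\<dots> = (\<Sum>a<p. ?h a)"
    using lt by (intro sum_cyclic_diff)
  also have "\<dots> = bcirc (A *\<^sub>T B) $$ (i, j)"
    using lt ij p by (simp add: index_bcirc[OF AB] index_t_prod[OF A B])
  finally show "bcirc (A *\<^sub>T B) $$ (i, j) = (bcirc A * bcirc B) $$ (i, j)" ..
qed (use bcirc_carrier[OF A p] bcirc_carrier[OF B p] bcirc_carrier[OF t_prod_tensors[OF A B p] p] in auto)

text \<open>Keeping the head and reversing the tail is the map \<open>k\<close> to \<open>-k\<close>
  modulo the number of slices.\<close>

lemma nth_slice_reversal:
  assumes "k < length A"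
  shows "(hd A # rev (tl A)) ! k = A ! cyclic_diff (length A) 0 k"
proof (cases k)
  case 0
  then show ?thesis using assms by (cases A) (auto simp: cyclic_diff_def)
next
  case (Suc k')
  then show ?thesis using assms by (cases A) (auto simp: cyclic_diff_def rev_nth Suc_diff_Suc)
qed

text \<open>Serves transpose and adjoint together: \<open>h\<close> is the operation on slices and
  \<open>\<phi>\<close> its effect on a single entry, the identity or conjugation. Negating the
  slice number exchanges block row and block column.\<close>

lemma bcirc_slice_reversal:
  assumes A: "A \<in> tensors m n p" and p: "0 < p"
    and h: "\<And>M. M \<in> carrier_mat m n \<Longrightarrow> h M \<in> carrier_mat n m"
    and idx: "\<And>M i j. M \<in> carrier_mat m n \<Longrightarrow> i < n \<Longrightarrow> j < m \<Longrightarrow> h M $$ (i, j) = \<phi> (M $$ (j, i))"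
  defines "B \<equiv> map h (hd A # rev (tl A))"
  shows "B \<in> tensors n m p" "\<And>i j. i < n * p \<Longrightarrow> j < m * p \<Longrightarrow> bcirc B $$ (i, j) = \<phi> (bcirc A $$ (j, i))"
proof -
  have len: "length B = p" using tensorsD(1)[OF A] p by (simp add: B_def)
  have nth: "B ! k = h (A ! cyclic_diff p 0 k)" if "k < p" for k
    using that len nth_slice_reversal[of k A] tensorsD(1)[OF A] nth_map[of k "hd A # rev (tl A)" h]
    unfolding B_def by (metis length_map)
  show B: "B \<in> tensors n m p"
    using len nth h tensorsD(2)[OF A] p by (auto simp: tensors_def in_set_conv_nth)
  fix i j assume ij: "i < n * p" "j < m * p"
  then show "bcirc B $$ (i, j) = \<phi> (bcirc A $$ (j, i))"
    using p tensorsD(2)[OF A] block_div_less[OF ij(1)] block_div_less[OF ij(2)]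
      block_mod_less[OF ij(1)] block_mod_less[OF ij(2)]
    by (simp add: index_bcirc[OF A] index_bcirc[OF B] nth idx cyclic_diff_swap)
qed

lemma
  assumes A: "A \<in> tensors m n p" and p: "0 < p"
  shows t_adjoint_tensors: "t_adjoint A \<in> tensors n m p"
    and bcirc_t_adjoint: "bcirc (t_adjoint A) = mat_adjoint (bcirc A)"
proof -
  note r = bcirc_slice_reversal[OF A p, of mat_adjoint cnj, folded t_adjoint_def]
  show B: "t_adjoint A \<in> tensors n m p" by (rule r) auto
  show "bcirc (t_adjoint A) = mat_adjoint (bcirc A)"
    using bcirc_carrier[OF A p] bcirc_carrier[OF B p] by (intro eq_matI) (auto intro!: r)
qed

lemma
  assumes A: "A \<in> tensors m n p" and p: "0 < p"
  shows t_transpose_tensors: "t_transpose A \<in> tensors n m p"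
    and bcirc_t_transpose: "bcirc (t_transpose A) = transpose_mat (bcirc A)"
proof -
  note r = bcirc_slice_reversal[OF A p, of transpose_mat "\<lambda>x. x", folded t_transpose_def]
  show B: "t_transpose A \<in> tensors n m p" by (rule r) auto
  show "bcirc (t_transpose A) = transpose_mat (bcirc A)"
    using bcirc_carrier[OF A p] bcirc_carrier[OF B p] by (intro eq_matI) (auto intro!: r)
qed

lemma
  assumes p: "0 < p"
  shows t_id_tensors: "t_id n p \<in> tensors n n p"
    and bcirc_t_id: "bcirc (t_id n p) = 1\<^sub>m (n * p)"
proof -
  show I: "t_id n p \<in> tensors n n p" using p by (auto simp: tensors_def t_id_def)
  have nth: "t_id n p ! k = (if k = 0 then 1\<^sub>m n else 0\<^sub>m n n)" if "k < p" for k
    using that by (auto simp: t_id_def nth_Cons')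
  show "bcirc (t_id n p) = 1\<^sub>m (n * p)"
  proof (intro eq_matI)
    fix i j assume "i < dim_row (1\<^sub>m (n * p) :: complex mat)" "j < dim_col (1\<^sub>m (n * p) :: complex mat)"
    then have ij: "i < n * p" "j < n * p" by auto
    then show "bcirc (t_id n p) $$ (i, j) = 1\<^sub>m (n * p) $$ (i, j)"
      using p block_div_less[OF ij(1)] block_div_less[OF ij(2)] block_mod_less[OF ij(1)] block_mod_less[OF ij(2)]
      by (auto simp: index_bcirc[OF I] nth dest: block_index_eq)
  qed (use bcirc_carrier[OF I p] in auto)
qed

text \<open>Injectivity of \<open>bcirc\<close> lets both tensor equations be tested on matrices,
  where either one implies the other.\<close>

lemma t_unitary_iff:
  assumes p: "0 < p"
  shows "t_unitary n p Q \<longleftrightarrow> Q \<in> tensors n n p \<and> unitary_mat (n * p) (bcirc Q)"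
proof (cases "Q \<in> tensors n n p")
  case True
  note Q = True t_adjoint_tensors[OF True p]
  have inj: "X = t_id n p \<longleftrightarrow> bcirc X = 1\<^sub>m (n * p)" if "X \<in> tensors n n p" for X
    using inj_onD[OF inj_on_bcirc _ that t_id_tensors[OF p]] bcirc_t_id[OF p, of n] by auto
  show ?thesis
    using Q bcirc_carrier[OF Q(1) p] unitary_matD(3)[of "n * p" "bcirc Q"] p
    by (auto simp: t_unitary_def unitary_mat_def inj t_prod_tensors bcirc_t_prod[of _ n n _ _ n] bcirc_t_adjoint)
qed (simp add: t_unitary_def)

section \<open>The block Fourier transform\<close>

text \<open>The power \<open>\<omega>^m\<close> of \<open>\<omega> = e^(-2 pi i / p)\<close>, with
  an integer exponent so that conjugates and differences of block indices can be written
  directly.\<close>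

definition unit_root :: "nat \<Rightarrow> int \<Rightarrow> complex" where
  "unit_root p m = cis (- (2 * pi) * real_of_int m / real p)"

lemma unit_root_add: "unit_root p (a + b) = unit_root p a * unit_root p b"
  by (simp add: unit_root_def cis_mult algebra_simps add_divide_distrib diff_divide_distrib)

lemma unit_root_0 [simp]: "unit_root p 0 = 1"
  by (simp add: unit_root_def)

lemma cnj_unit_root [simp]: "cnj (unit_root p a) = unit_root p (- a)"
  by (simp add: unit_root_def cis_cnj)

lemma unit_root_power: "unit_root p a ^ k = unit_root p (a * int k)"
  by (simp add: unit_root_def DeMoivre algebra_simps)

lemma unit_root_eq_1_iff:
  assumes "0 < p"
  shows "unit_root p a = 1 \<longleftrightarrow> int p dvd a"
proof
  assume "int p dvd a"
  then obtain b where "a = int p * b" by auto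
  then have "unit_root p a = cis (2 * pi * real_of_int (- b))"
    using assms by (simp add: unit_root_def algebra_simps)
  then show "unit_root p a = 1" by (simp only: cis_multiple_2pi Ints_of_int)
next
  assume "unit_root p a = 1"
  \<comment> \<open>The real part alone decides: the cosine is 1 only at integer multiples of
    \<open>2 * pi\<close>.\<close>
  then have "cos (- (2 * pi) * real_of_int a / real p) = 1"
    unfolding unit_root_def by (metis cis.sel(1) one_complex.sel(1))
  then obtain k :: int where "- (2 * pi) * real_of_int a / real p = real_of_int k * 2 * pi"
    using cos_one_2pi_int by blast
  then have "pi * real_of_int a = pi * real_of_int (- k * int p)"
    using assms by (simp add: field_simps)
  then have "real_of_int a = real_of_int (- k * int p)" by (simp only: mult_left_cancel[OF pi_neq_zero])
  then have "a = - k * int p" by (simp only: of_int_eq_iff)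
  then show "int p dvd a" by simp
qed

lemma unit_root_cong:
  assumes "0 < p" "int p dvd a - b"
  shows "unit_root p a = unit_root p b"
  using unit_root_add[of p b "a - b"] unit_root_eq_1_iff[OF assms(1)] assms(2) by simp

text \<open>A geometric sum with ratio \<open>unit_root p a\<close>, whose \<open>p\<close>-th power
  is 1: it vanishes unless the ratio itself is 1.\<close>

lemma sum_unit_root:
  assumes "0 < p"
  shows "(\<Sum>l<p. unit_root p (a * int l)) = (if int p dvd a then of_nat p else 0)"
proof (cases "int p dvd a")
  case True
  then have "unit_root p (a * int l) = 1" for l using unit_root_eq_1_iff[OF assms] by simp
  then show ?thesis using True by simp
next
  case False
  have "unit_root p a ^ p = 1"
    using unit_root_eq_1_iff[OF assms] by (simp add: unit_root_power)
  then show ?thesis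
    using False unit_root_eq_1_iff[OF assms, of a] geometric_sum[of "unit_root p a" p]
    by (simp add: unit_root_power)
qed

lemma sum_unit_root_diff:
  assumes "x < p" "y < p"
  shows "(\<Sum>l<p. unit_root p ((int x - int y) * int l)) = (if x = y then of_nat p else 0)"
proof -
  have "int p dvd int x - int y \<longleftrightarrow> int x mod int p = int y mod int p"
    by (simp add: mod_eq_dvd_iff)
  also have "\<dots> \<longleftrightarrow> x = y" using assms by simp
  finally show ?thesis using assms by (subst sum_unit_root) auto
qed

section \<open>The Fourier matrix and its block version\<close>

lemma index_dft_mat:
  assumes "j < p" "k < p"
  shows "dft_mat p $$ (j, k) = unit_root p (int j * int k) / complex_of_real (sqrt (real p))"
proof -
  have "cis (- (2 * pi) / real p) = unit_root p 1" by (simp add: unit_root_def)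
  then show ?thesis using assms by (simp add: dft_mat_def unit_root_power)
qed

lemma dft_mat_mult_cnj:
  assumes "x < p" "l < p" "y < p"
  shows "dft_mat p $$ (x, l) * cnj (dft_mat p $$ (y, l)) = unit_root p ((int x - int y) * int l) / of_nat p"
proof -
  have "unit_root p ((int x - int y) * int l) = unit_root p (int x * int l) * unit_root p (- (int y * int l))"
    by (simp add: left_diff_distrib flip: unit_root_add)
  moreover have "complex_of_real (sqrt (real p)) * complex_of_real (sqrt (real p)) = of_nat p"
    by (simp flip: of_real_mult)
  ultimately show ?thesis using assms by (simp add: index_dft_mat)
qed

abbreviation block_dft :: "nat \<Rightarrow> nat \<Rightarrow> complex mat" where
  "block_dft p n \<equiv> kron (dft_mat p) (1\<^sub>m n)"

lemma block_dft_carrier: "block_dft p n \<in> carrier_mat (n * p) (n * p)"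
  by (simp add: kron_def dft_mat_def mult.commute)

lemma index_block_dft:
  assumes "i < n * p" "j < n * p"
  shows "block_dft p n $$ (i, j) = (if i mod n = j mod n then dft_mat p $$ (i div n, j div n) else 0)"
  using assms block_mod_less[OF assms(1)] block_mod_less[OF assms(2)]
  by (simp add: kron_def dft_mat_def mult.commute)

lemma kron_adjoint_dft: "kron (mat_adjoint (dft_mat p)) (1\<^sub>m n) = mat_adjoint (block_dft p n)"
proof (intro eq_matI)
  fix i j assume "i < dim_row (mat_adjoint (block_dft p n))" "j < dim_col (mat_adjoint (block_dft p n))"
  then have ij: "i < p * n" "j < p * n" by (auto simp: kron_def dft_mat_def)
  have d: "dim_row (dft_mat p) = p" "dim_col (dft_mat p) = p" by (auto simp: dft_mat_def)
  show "kron (mat_adjoint (dft_mat p)) (1\<^sub>m n) $$ (i, j) = mat_adjoint (block_dft p n) $$ (i, j)"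
    using ij block_div_less[of i n p] block_div_less[of j n p] block_mod_less[of i n p] block_mod_less[of j n p]
    by (auto simp: kron_def d mult.commute)
qed (auto simp: kron_def dft_mat_def)

lemma unitary_block_dft: "unitary_mat (n * p) (block_dft p n)"
proof -
  note W = block_dft_carrier[of p n]
  have "mat_adjoint (block_dft p n) * block_dft p n = 1\<^sub>m (n * p)"
  proof (intro eq_matI)
    fix i j assume "i < dim_row (1\<^sub>m (n * p) :: complex mat)" "j < dim_col (1\<^sub>m (n * p) :: complex mat)"
    then have ij: "i < n * p" "j < n * p" by auto
    note lt = block_div_less[OF ij(1)] block_div_less[OF ij(2)] block_mod_less[OF ij(1)] block_mod_less[OF ij(2)]
    \<comment> \<open>The product pairs two columns, while \<open>dft_mat_mult_cnj\<close> pairs two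
      rows; symmetry of the Fourier matrix passes from one to the other.\<close>
    have sym: "dft_mat p $$ (a, b) = dft_mat p $$ (b, a)" if "a < p" "b < p" for a b
      using that by (simp add: index_dft_mat mult.commute)
    have "(mat_adjoint (block_dft p n) * block_dft p n) $$ (i, j) =
        (\<Sum>l<n * p. mat_adjoint (block_dft p n) $$ (i, l) * block_dft p n $$ (l, j))"
      using W ij by (intro index_mult_mat_sum) auto
    also have "\<dots> = (\<Sum>a<p. \<Sum>b<n. if b = i mod n then
        (if i mod n = j mod n then cnj (dft_mat p $$ (a, i div n)) * dft_mat p $$ (a, j div n) else 0) else 0)"
      unfolding sum_blocks using lt ij W
      by (intro sum.cong refl) (auto simp: index_block_dft block_index_less)
    also have "\<dots> = (\<Sum>a<p. if i mod n = j mod n then dft_mat p $$ (j div n, a) * cnj (dft_mat p $$ (i div n, a)) else 0)"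
      using lt by (intro sum.cong refl) (simp add: sym[of "i div n"] sym[of "j div n"] mult.commute)
    also have "\<dots> = (if i mod n = j mod n then
        (\<Sum>a<p. unit_root p ((int (j div n) - int (i div n)) * int a)) / of_nat p else 0)"
      using lt by (simp add: dft_mat_mult_cnj sum_divide_distrib del: of_nat_div of_nat_diff)
    also have "\<dots> = 1\<^sub>m (n * p) $$ (i, j)"
      using lt ij by (auto simp: sum_unit_root_diff simp del: of_nat_div dest: block_index_eq)
    finally show "(mat_adjoint (block_dft p n) * block_dft p n) $$ (i, j) = 1\<^sub>m (n * p) $$ (i, j)" .
  qed (use W in auto)
  then show ?thesis using W by (simp add: unitary_mat_def)
qed

section \<open>Block diagonal matrices with square blocks of equal size\<close>

abbreviation diag_blocks :: "nat \<Rightarrow> (nat \<Rightarrow> 'a::zero mat) \<Rightarrow> 'a mat" where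
  "diag_blocks p D \<equiv> diag_block_mat (map D [0..<p])"

lemma diag_blocks_carrier:
  "(\<And>l. l < p \<Longrightarrow> D l \<in> carrier_mat n n) \<Longrightarrow> diag_blocks p D \<in> carrier_mat (n * p) (n * p)"
proof (induction p)
  case (Suc p)
  then have "diag_blocks p D \<in> carrier_mat (n * p) (n * p)" "D p \<in> carrier_mat n n" by auto
  from four_block_carrier_mat[OF this] show ?case
    using \<open>diag_blocks p D \<in> _\<close> by (simp add: diag_block_mat_last Let_def add.commute del: four_block_carrier_mat)
qed auto

text \<open>By induction, splitting off the last block: indices from \<open>n * p\<close> on have
  quotient \<open>p\<close> and fall into that block, smaller ones into the block diagonal matrix of
  the first \<open>p\<close> blocks.\<close>

lemma index_diag_blocks:
  assumes "\<And>l. l < p \<Longrightarrow> D l \<in> carrier_mat n n" "i < n * p" "j < n * p"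
  shows "diag_blocks p D $$ (i, j) = (if i div n = j div n then D (i div n) $$ (i mod n, j mod n) else 0)"
  using assms
proof (induction p)
  case (Suc p)
  have c: "diag_blocks p D \<in> carrier_mat (n * p) (n * p)" "D p \<in> carrier_mat n n"
    using Suc.prems by (auto intro: diag_blocks_carrier)
  have div: "k div n = p" "k mod n = k - n * p" if "\<not> k < n * p" "k < n * Suc p" for k
  proof -
    show "k div n = p" using that by (intro div_nat_eqI) (auto simp: mult.commute)
    then show "k mod n = k - n * p" by (simp add: minus_mult_div_eq_mod[symmetric])
  qed
  have lt: "k div n < p" if "k < n * p" for k using block_div_less[OF that] .
  show ?case
    using Suc carrier_matD[OF c(1)] carrier_matD[OF c(2)] div[of i] div[of j] lt[of i] lt[of j]
    by (auto simp: diag_block_mat_last Let_def)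
qed simp

lemma diag_blocks_mult:
  assumes D: "\<And>l. l < p \<Longrightarrow> D l \<in> carrier_mat n n" and E: "\<And>l. l < p \<Longrightarrow> E l \<in> carrier_mat n n"
  shows "diag_blocks p D * diag_blocks p E = diag_blocks p (\<lambda>l. D l * E l :: complex mat)"
proof (intro eq_matI)
  have DE: "D l * E l \<in> carrier_mat n n" if "l < p" for l
    using mult_carrier_mat[OF D[OF that] E[OF that]] .
  note c = diag_blocks_carrier[of p D, OF D] diag_blocks_carrier[of p E, OF E] diag_blocks_carrier[of p "\<lambda>l. D l * E l", OF DE]
  fix i j assume "i < dim_row (diag_blocks p (\<lambda>l. D l * E l))" "j < dim_col (diag_blocks p (\<lambda>l. D l * E l))"
  then have ij: "i < n * p" "j < n * p" using c(3) by auto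
  note lt = block_div_less[OF ij(1)] block_div_less[OF ij(2)] block_mod_less[OF ij(1)] block_mod_less[OF ij(2)]
  have "(diag_blocks p D * diag_blocks p E) $$ (i, j) =
      (\<Sum>l<n * p. diag_blocks p D $$ (i, l) * diag_blocks p E $$ (l, j))"
    using c ij by (intro index_mult_mat_sum) auto
  also have "\<dots> = (\<Sum>a<p. if a = i div n then (if i div n = j div n then
      (\<Sum>b<n. D (i div n) $$ (i mod n, b) * E (i div n) $$ (b, j mod n)) else 0) else 0)"
    unfolding sum_blocks using lt ij
    by (intro sum.cong refl) (auto simp: index_diag_blocks[where n = n] D E block_index_less)
  also have "\<dots> = (if i div n = j div n then (D (i div n) * E (i div n)) $$ (i mod n, j mod n) else 0)"
    using lt by (simp add: index_mult_mat_sum[OF D E] del: index_mult_mat)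
  also have "\<dots> = diag_blocks p (\<lambda>l. D l * E l) $$ (i, j)"
    using ij by (subst index_diag_blocks[OF DE]) auto
  finally show "(diag_blocks p D * diag_blocks p E) $$ (i, j) = diag_blocks p (\<lambda>l. D l * E l) $$ (i, j)" .
next
  have DE: "D l * E l \<in> carrier_mat n n" if "l < p" for l
    using mult_carrier_mat[OF D[OF that] E[OF that]] .
  note c = diag_blocks_carrier[of p D, OF D] diag_blocks_carrier[of p E, OF E] diag_blocks_carrier[of p "\<lambda>l. D l * E l", OF DE]
  show "dim_row (diag_blocks p D * diag_blocks p E) = dim_row (diag_blocks p (\<lambda>l. D l * E l))"
    "dim_col (diag_blocks p D * diag_blocks p E) = dim_col (diag_blocks p (\<lambda>l. D l * E l))"
    using c by auto
qed

lemma mat_adjoint_diag_blocks: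
  assumes D: "\<And>l. l < p \<Longrightarrow> D l \<in> carrier_mat n n"
  shows "mat_adjoint (diag_blocks p D) = diag_blocks p (\<lambda>l. mat_adjoint (D l :: complex mat))"
proof (intro eq_matI)
  have D': "mat_adjoint (D l) \<in> carrier_mat n n" if "l < p" for l using that D by auto
  note c = diag_blocks_carrier[of p D, OF D] diag_blocks_carrier[of p "\<lambda>l. mat_adjoint (D l)", OF D']
  show "dim_row (mat_adjoint (diag_blocks p D)) = dim_row (diag_blocks p (\<lambda>l. mat_adjoint (D l)))"
    "dim_col (mat_adjoint (diag_blocks p D)) = dim_col (diag_blocks p (\<lambda>l. mat_adjoint (D l)))"
    using c by auto
  fix i j assume "i < dim_row (diag_blocks p (\<lambda>l. mat_adjoint (D l)))" "j < dim_col (diag_blocks p (\<lambda>l. mat_adjoint (D l)))"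
  then have ij: "i < n * p" "j < n * p" using c by auto
  note lt = block_div_less[OF ij(1)] block_div_less[OF ij(2)] block_mod_less[OF ij(1)] block_mod_less[OF ij(2)]
  have dim: "dim_row (D l) = n" "dim_col (D l) = n" if "l < p" for l using D[OF that] by auto
  show "mat_adjoint (diag_blocks p D) $$ (i, j) = diag_blocks p (\<lambda>l. mat_adjoint (D l)) $$ (i, j)"
    using c(1) ij lt by (subst index_diag_blocks[OF D']) (auto simp: index_diag_blocks[of p D, OF D] dim)
qed

lemma unitary_diag_blocks:
  assumes "\<And>l. l < p \<Longrightarrow> unitary_mat n (U l)"
  shows "unitary_mat (n * p) (diag_blocks p U)"
proof -
  note c = unitary_matD(1)[OF assms]
  \<comment> \<open>Unitarity is known only for \<open>l < p\<close>, so the two block functions are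
    compared along the list and not as functions.\<close>
  have "map (\<lambda>l. mat_adjoint (U l) * U l) [0..<p] = map (\<lambda>_. 1\<^sub>m n) [0..<p]"
    using unitary_matD(2)[OF assms] by (intro map_cong) auto
  then have "mat_adjoint (diag_blocks p U) * diag_blocks p U = diag_blocks p (\<lambda>_. 1\<^sub>m n)"
    using mat_adjoint_diag_blocks[of p U, OF c] diag_blocks_mult[of p "\<lambda>l. mat_adjoint (U l)" n U] c
    by (simp only: mat_adjoint_carrier)
  also have "\<dots> = 1\<^sub>m (n * p)"
    using diag_blocks_carrier[of p "\<lambda>_. 1\<^sub>m n :: complex mat" n]
    by (intro eq_matI) (auto simp: index_diag_blocks[where n = n] block_mod_less dest: block_index_eq)
  finally show ?thesis using diag_blocks_carrier[of p U, OF c] by (simp add: unitary_mat_def)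
qed

section \<open>Passing between Fourier blocks and slices\<close>

lemma undo_dft_conjugation:
  "length Ds = p \<Longrightarrow> undo_dft n n Ds = block_dft p n * diag_block_mat Ds * mat_adjoint (block_dft p n)"
  by (simp add: undo_dft_def kron_adjoint_dft)

text \<open>The two Fourier factors combine into a root of unity that sees only the difference of
  the block indices. This is why conjugation by the block Fourier matrix turns every block diagonal
  matrix into a block circulant one.\<close>

lemma index_undo_dft:
  assumes D: "\<And>l. l < p \<Longrightarrow> D l \<in> carrier_mat n n" and ij: "i < n * p" "j < n * p"
  shows "undo_dft n n (map D [0..<p]) $$ (i, j) =
    (\<Sum>l<p. unit_root p ((int (i div n) - int (j div n)) * int l) * D l $$ (i mod n, j mod n)) / of_nat p"
proof -
  note W = block_dft_carrier[of p n] and cD = diag_blocks_carrier[of p D, OF D]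
  note lt = block_div_less[OF ij(1)] block_div_less[OF ij(2)] block_mod_less[OF ij(1)] block_mod_less[OF ij(2)]
  have WD: "(block_dft p n * diag_blocks p D) $$ (i, a * n + b) = dft_mat p $$ (i div n, a) * D a $$ (i mod n, b)"
    if ab: "a < p" "b < n" for a b
  proof -
    have "(block_dft p n * diag_blocks p D) $$ (i, a * n + b) =
        (\<Sum>l<n * p. block_dft p n $$ (i, l) * diag_blocks p D $$ (l, a * n + b))"
      using W cD ij ab by (intro index_mult_mat_sum) (auto simp: block_index_less)
    also have "\<dots> = (\<Sum>a'<p. \<Sum>b'<n. if b' = i mod n then (if a' = a then
        dft_mat p $$ (i div n, a) * D a $$ (i mod n, b) else 0) else 0)"
      unfolding sum_blocks using lt ij ab
      by (intro sum.cong refl) (auto simp: index_diag_blocks[of p D, OF D] index_block_dft block_index_less)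
    finally show ?thesis using lt ab by simp
  qed
  have "undo_dft n n (map D [0..<p]) $$ (i, j) =
      (\<Sum>l<n * p. (block_dft p n * diag_blocks p D) $$ (i, l) * mat_adjoint (block_dft p n) $$ (l, j))"
    unfolding undo_dft_conjugation[of "map D [0..<p]" p n, simplified]
    using W cD ij by (intro index_mult_mat_sum) auto
  also have "\<dots> = (\<Sum>a<p. \<Sum>b<n. if b = j mod n then
      dft_mat p $$ (i div n, a) * cnj (dft_mat p $$ (j div n, a)) * D a $$ (i mod n, j mod n) else 0)"
    unfolding sum_blocks using lt ij W
    by (intro sum.cong refl) (auto simp: WD index_block_dft block_index_less simp del: index_mult_mat)
  also have "\<dots> = (\<Sum>a<p. unit_root p ((int (i div n) - int (j div n)) * int a) / of_nat p * D a $$ (i mod n, j mod n))"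
    using lt by (intro sum.cong refl) (simp add: dft_mat_mult_cnj del: of_nat_div)
  finally show ?thesis by (simp add: sum_divide_distrib)
qed

text \<open>The tensor with Fourier blocks \<open>D\<close>, read off the first block column of
  \<open>undo_dft\<close>. The two factors \<open>p^(-1/2)\<close> of the Fourier matrix and its
  adjoint give the division by \<open>p\<close>.\<close>

definition inverse_dft :: "nat \<Rightarrow> nat \<Rightarrow> (nat \<Rightarrow> complex mat) \<Rightarrow> complex tensor" where
  "inverse_dft n p D = map (\<lambda>k. mat n n (\<lambda>(r, s).
     (\<Sum>l<p. unit_root p (int k * int l) * D l $$ (r, s)) / of_nat p)) [0..<p]"

lemma inverse_dft_tensors: "inverse_dft n p D \<in> tensors n n p"
  by (auto simp: inverse_dft_def tensors_def)

text \<open>The cyclic difference is congruent modulo \<open>p\<close> to the true difference of the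
  block indices, and \<open>unit_root p\<close> depends only on the residue.\<close>

lemma bcirc_inverse_dft:
  assumes D: "\<And>l. l < p \<Longrightarrow> D l \<in> carrier_mat n n" and p: "0 < p"
  shows "bcirc (inverse_dft n p D) = undo_dft n n (map D [0..<p])"
proof (intro eq_matI)
  note T = inverse_dft_tensors[of n p D]
  have c: "undo_dft n n (map D [0..<p]) \<in> carrier_mat (n * p) (n * p)"
    using diag_blocks_carrier[of p D, OF D] block_dft_carrier[of p n]
    by (auto simp: undo_dft_conjugation intro!: mult_carrier_mat)
  show "dim_row (bcirc (inverse_dft n p D)) = dim_row (undo_dft n n (map D [0..<p]))"
    "dim_col (bcirc (inverse_dft n p D)) = dim_col (undo_dft n n (map D [0..<p]))"
    using c bcirc_carrier[OF T p] by auto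
  fix i j assume "i < dim_row (undo_dft n n (map D [0..<p]))" "j < dim_col (undo_dft n n (map D [0..<p]))"
  then have ij: "i < n * p" "j < n * p" using c by auto
  note lt = block_div_less[OF ij(1)] block_div_less[OF ij(2)] block_mod_less[OF ij(1)] block_mod_less[OF ij(2)]
  let ?k = "cyclic_diff p (i div n) (j div n)"
  have "unit_root p (int ?k * int l) = unit_root p ((int (i div n) - int (j div n)) * int l)" for l
  proof (rule unit_root_cong[OF p])
    have "int p dvd int ?k - (int (i div n) - int (j div n))"
      using lt by (subst int_cyclic_diff) (auto simp: mod_eq_dvd_iff[symmetric] simp del: of_nat_div)
    then show "int p dvd int ?k * int l - (int (i div n) - int (j div n)) * int l"
      by (simp add: left_diff_distrib[symmetric] del: of_nat_div)
  qed
  then show "bcirc (inverse_dft n p D) $$ (i, j) = undo_dft n n (map D [0..<p]) $$ (i, j)"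
    unfolding index_bcirc[OF T ij] using lt p by (simp add: index_undo_dft[of p D, OF D ij] inverse_dft_def del: of_nat_div)
qed

lemma inverse_dft_surj:
  assumes A: "A \<in> tensors n n p" and p: "0 < p"
  obtains D where "\<And>l. D l \<in> carrier_mat n n" "A = inverse_dft n p D"
proof
  \<comment> \<open>Fourier inversion: the opposite sign in the exponent and no factor
    \<open>1/p\<close>, since \<open>inverse_dft\<close> already carries it.\<close>
  let ?D = "\<lambda>l. mat n n (\<lambda>(r, s). \<Sum>k<p. unit_root p (- int k * int l) * A ! k $$ (r, s))"
  show "?D l \<in> carrier_mat n n" for l by simp
  show "A = inverse_dft n p ?D"
    using A inverse_dft_tensors
  proof (rule tensors_eqI)
    fix k r s assume *: "k < p" "r < n" "s < n"
    have "(\<Sum>l<p. unit_root p (int k * int l) * (\<Sum>j<p. unit_root p (- int j * int l) * A ! j $$ (r, s))) =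
        (\<Sum>l<p. \<Sum>j<p. unit_root p ((int k - int j) * int l) * A ! j $$ (r, s))"
      by (intro sum.cong refl) (simp add: sum_distrib_left left_diff_distrib mult.assoc[symmetric] flip: unit_root_add)
    also have "\<dots> = (\<Sum>j<p. (\<Sum>l<p. unit_root p ((int k - int j) * int l)) * A ! j $$ (r, s))"
      by (subst sum.swap) (simp add: sum_distrib_right)
    also have "\<dots> = (\<Sum>j<p. if j = k then of_nat p * A ! k $$ (r, s) else 0)"
      using * by (intro sum.cong refl) (auto simp: sum_unit_root_diff)
    finally show "A ! k $$ (r, s) = inverse_dft n p ?D ! k $$ (r, s)"
      using * p by (simp add: inverse_dft_def)
  qed
qed

section \<open>Singular value decompositions of tensors\<close>

text \<open>\<open>the_inv_into\<close> is meaningful only on the image of \<open>bcirc\<close>; the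
  explicit preimage \<open>inverse_dft n p D\<close> shows that the matrix lies there.\<close>

lemma bcirc_bcirc_inv_undo_dft:
  assumes D: "\<And>l. l < p \<Longrightarrow> D l \<in> carrier_mat n n" and p: "0 < p"
  shows "bcirc_inv n n p (undo_dft n n (map D [0..<p])) \<in> tensors n n p"
    "bcirc (bcirc_inv n n p (undo_dft n n (map D [0..<p]))) = undo_dft n n (map D [0..<p])"
proof -
  have "bcirc_inv n n p (undo_dft n n (map D [0..<p])) = inverse_dft n p D"
    using the_inv_into_f_f[OF inj_on_bcirc inverse_dft_tensors, of n p D]
    by (simp add: bcirc_inv_def bcirc_inverse_dft[of p D, OF D p])
  then show "bcirc_inv n n p (undo_dft n n (map D [0..<p])) \<in> tensors n n p"
    "bcirc (bcirc_inv n n p (undo_dft n n (map D [0..<p]))) = undo_dft n n (map D [0..<p])"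
    using inverse_dft_tensors[of n p D] bcirc_inverse_dft[of p D, OF D p] by auto
qed

lemma is_tsvd_exists:
  assumes A: "A \<in> tensors n n p" and p: "0 < p"
  shows "\<exists>U S \<Sigma> V. is_tsvd n n p A U S \<Sigma> V"
proof -
  obtain D where D: "\<And>l. D l \<in> carrier_mat n n" and AD: "A = inverse_dft n p D"
    using inverse_dft_surj[OF A p] by blast
  \<comment> \<open>The blocks have the right size for every \<open>l\<close>, so decompositions can
    be chosen as total functions of \<open>l\<close> without a bound.\<close>
  have "\<forall>l. \<exists>U S V. unitary_mat n U \<and> unitary_mat n V \<and> S \<in> carrier_mat n n \<and> diagonal_mat S \<and>
      (\<forall>x \<in> elements_mat S. 0 \<le> x) \<and> D l = U * map_mat complex_of_real S * mat_adjoint V"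
    using singular_value_decomposition[OF D] by blast
  then obtain U S V where U: "\<And>l. unitary_mat n (U l)" and V: "\<And>l. unitary_mat n (V l)"
    and S: "\<And>l. S l \<in> carrier_mat n n" "\<And>l. diagonal_mat (S l)" "\<And>l. \<forall>x \<in> elements_mat (S l). 0 \<le> x"
    and DS: "\<And>l. D l = U l * map_mat complex_of_real (S l) * mat_adjoint (V l)"
    by metis
  let ?S = "\<lambda>l. map_mat complex_of_real (S l)" and ?W = "block_dft p n"
  have S': "?S l \<in> carrier_mat n n" for l using S(1)[of l] by simp
  note cU = unitary_matD(1)[OF U] and cV = unitary_matD(1)[OF V]
  note dU = diag_blocks_carrier[of p U n, OF cU] and dV = diag_blocks_carrier[of p V n, OF cV]
    and dS = diag_blocks_carrier[of p ?S n, OF S'] and cW = block_dft_carrier[of p n]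
  note uW = unitary_block_dft[of n p]
  note [simp] = assoc_mult_mat[of _ "n * p" "n * p" _ "n * p" _ "n * p"]
    mult_carrier_mat[of _ "n * p" "n * p" _ "n * p"] mat_adjoint_mult[of _ "n * p" "n * p" _ "n * p"]
  have bc: "bcirc (inverse_dft n p E) = ?W * diag_blocks p E * mat_adjoint ?W"
    if "\<And>l. E l \<in> carrier_mat n n" for E
    using bcirc_inverse_dft[of p E n, OF that p] by (simp add: undo_dft_conjugation)
  \<comment> \<open>In the Fourier basis a tensor is unitary as soon as its blocks are: its
    \<open>bcirc\<close> is a product of three unitary matrices.\<close>
  have unitary: "t_unitary n p (inverse_dft n p E)" if E: "\<And>l. unitary_mat n (E l)" for E
  proof -
    have "unitary_mat (n * p) (mat_adjoint ?W)"
      using uW unitary_matD(3)[OF uW] cW by (simp add: unitary_mat_def)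
    then show ?thesis
      using inverse_dft_tensors bc[of E, OF unitary_matD(1)[OF E]] unitary_diag_blocks[of p n E, OF E] uW
      by (auto simp: t_unitary_iff[OF p] intro!: unitary_mat_mult)
  qed
  note T = inverse_dft_tensors[of n p]
  have cancel: "mat_adjoint ?W * (?W * Z) = Z" if "Z \<in> carrier_mat (n * p) (n * p)" for Z
  proof -
    have "mat_adjoint ?W * (?W * Z) = (mat_adjoint ?W * ?W) * Z"
      using that cW by simp
    then show ?thesis using that by (simp add: unitary_matD(2)[OF uW])
  qed
  have "diag_blocks p D = diag_blocks p (\<lambda>l. U l * ?S l * mat_adjoint (V l))"
    using DS by (intro arg_cong[where f = "diag_blocks p"] ext)
  also have "\<dots> = diag_blocks p (\<lambda>l. U l * ?S l) * diag_blocks p (\<lambda>l. mat_adjoint (V l))"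
    using cU S' cV by (intro diag_blocks_mult[symmetric, of p _ n] mult_carrier_mat) auto
  also have "diag_blocks p (\<lambda>l. U l * ?S l) = diag_blocks p U * diag_blocks p ?S"
    using cU S' by (intro diag_blocks_mult[symmetric, of p _ n]) auto
  also have "diag_blocks p (\<lambda>l. mat_adjoint (V l)) = mat_adjoint (diag_blocks p V)"
    using cV by (intro mat_adjoint_diag_blocks[symmetric, of p _ n]) auto
  finally have blocks: "diag_blocks p D = diag_blocks p U * diag_blocks p ?S * mat_adjoint (diag_blocks p V)" .
  let ?U = "inverse_dft n p U" and ?V = "inverse_dft n p V" and ?T = "inverse_dft n p ?S"
  note TA = t_adjoint_tensors[OF T[of V] p] and US = t_prod_tensors[OF T[of U] T[of ?S] p]
  have "bcirc (?U *\<^sub>T ?T *\<^sub>T t_adjoint ?V) = bcirc ?U * bcirc ?T * mat_adjoint (bcirc ?V)"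
    by (simp add: bcirc_t_prod[OF US TA p] bcirc_t_prod[OF T T p] bcirc_t_adjoint[OF T p])
  also have "\<dots> = ?W * diag_blocks p U * mat_adjoint ?W * (?W * diag_blocks p ?S * mat_adjoint ?W) *
      mat_adjoint (?W * diag_blocks p V * mat_adjoint ?W)"
    by (simp only: bc[of U, OF cU] bc[of ?S, OF S'] bc[of V, OF cV])
  also have "\<dots> = ?W * (diag_blocks p U * (diag_blocks p ?S * (mat_adjoint (diag_blocks p V) * mat_adjoint ?W)))"
    using dU dV dS cW by (simp add: cancel)
  also have "\<dots> = bcirc A"
    using dU dV dS cW by (simp add: AD bc[of D, OF D] blocks)
  finally have "A = ?U *\<^sub>T ?T *\<^sub>T t_adjoint ?V"
    using inj_onD[OF inj_on_bcirc _ A t_prod_tensors[OF US TA p]] by simp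
  \<comment> \<open>Every slice is a linear combination of the diagonal blocks
    \<open>?S l\<close>.\<close>
  moreover have "F_diagonal ?T"
  proof -
    have "?S l $$ (i, j) = 0" if "i < n" "j < n" "i \<noteq> j" for l i j
      using S(1,2)[of l] that by (auto simp: diagonal_mat_def)
    then show ?thesis by (auto simp: F_diagonal_def inverse_dft_def diagonal_mat_def simp del: index_map_mat)
  qed
  moreover have "bcirc ?T = undo_dft n n (map (map_mat complex_of_real) (map S [0..<p]))"
    using bcirc_inverse_dft[of p ?S n, OF S' p] by (simp add: comp_def)
  ultimately have "is_tsvd n n p A ?U ?T (map S [0..<p]) ?V"
    using unitary[OF U] unitary[OF V] T S by (auto simp: is_tsvd_def)
  then show ?thesis by blast
qed

text \<open>The singular vectors of \<open>bcirc A\<close> are the columns of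
  \<open>bcirc U * W\<close> and \<open>bcirc V * W\<close> with the block Fourier matrix
  \<open>W\<close>. The limit \<open>B\<close> may depend on the T-SVD, but the terms of the series
  mention only \<open>A\<close>.\<close>

lemma tsvd_fun_series_sums:
  assumes A: "A \<in> tensors n n p" and p: "0 < p" and n: "0 < n"
    and svd: "is_tsvd n n p A U S \<Sigma> V"
    and f: "\<And>z. cmod z < R \<Longrightarrow> (\<lambda>k. c (2 * k + 1) * z ^ (2 * k + 1)) sums f z"
    and R: "t_norm2 A < R"
  defines "B \<equiv> U *\<^sub>T F_diagonal_fun f n n \<Sigma> *\<^sub>T t_adjoint V"
  shows "B \<in> tensors n n p"
    and "\<And>i j. i < n * p \<Longrightarrow> j < n * p \<Longrightarrow>
      (\<lambda>k. c (2 * k + 1) * odd_power (bcirc A) k $$ (i, j)) sums bcirc B $$ (i, j)"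
proof -
  let ?W = "block_dft p n"
  have U: "t_unitary n p U" and V: "t_unitary n p V" and S: "S \<in> tensors n n p"
    and len: "length \<Sigma> = p"
    and \<Sigma>: "\<And>D. D \<in> set \<Sigma> \<Longrightarrow> D \<in> carrier_mat n n \<and> diagonal_mat D \<and> (\<forall>x \<in> elements_mat D. 0 \<le> x)"
    and bS: "bcirc S = undo_dft n n (map (map_mat complex_of_real) \<Sigma>)"
    and A_eq: "A = U *\<^sub>T S *\<^sub>T t_adjoint V"
    using svd by (auto simp: is_tsvd_def)
  have \<Sigma>l: "\<Sigma> ! l \<in> carrier_mat n n" "diagonal_mat (\<Sigma> ! l)" "\<forall>x \<in> elements_mat (\<Sigma> ! l). 0 \<le> x"
    if "l < p" for l using \<Sigma>[of "\<Sigma> ! l"] that len by auto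
  have map\<Sigma>: "map h \<Sigma> = map (\<lambda>l. h (\<Sigma> ! l)) [0..<p]" for h :: "real mat \<Rightarrow> complex mat"
    by (rule nth_equalityI) (use len in auto)
  \<comment> \<open>All singular values of \<open>bcirc A\<close> in one sequence, the diagonals of
    the Fourier blocks one after the other.\<close>
  define d where "d = (\<lambda>i. \<Sigma> ! (i div n) $$ (i mod n, i mod n))"
  have d0: "0 \<le> d i" if "i < n * p" for i
    unfolding d_def using \<Sigma>l(1,3)[OF block_div_less[OF that]] block_mod_less[OF that] elements_matI by blast
  have entry: "\<Sigma> ! (i div n) $$ (i mod n, j mod n) = (if i = j then d i else 0)"
    if "i < n * p" "j < n * p" "i div n = j div n" for i j
  proof (cases "i = j")
    case False
    then have "i mod n \<noteq> j mod n" using block_index_eq[OF that(3)] by blast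
    then show ?thesis
      using False \<Sigma>l(2)[OF block_div_less[OF that(1)]] carrier_matD[OF \<Sigma>l(1)[OF block_div_less[OF that(1)]]]
        block_mod_less[OF that(1)] block_mod_less[OF that(2)]
      unfolding diagonal_mat_def by metis
  qed (simp add: d_def)
  have nonneg_entry: "0 \<le> \<Sigma> ! l $$ (r, s)" if "l < p" "r < n" "s < n" for l r s
    using \<Sigma>l(1,3)[OF that(1)] that(2,3) elements_matI by blast
  have C: "map_mat complex_of_real (\<Sigma> ! l) \<in> carrier_mat n n" "sv_fun f (\<Sigma> ! l) \<in> carrier_mat n n"
    if "l < p" for l using \<Sigma>l(1)[OF that] by (auto simp: sv_fun_def)
  have diag1: "diag_block_mat (map (map_mat complex_of_real) \<Sigma>) =
      diagonal_of (n * p) (\<lambda>i. complex_of_real (d i))"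
    unfolding map\<Sigma> using diag_blocks_carrier[of p "\<lambda>l. map_mat complex_of_real (\<Sigma> ! l)", OF C(1)]
  proof (intro eq_matI)
    fix i j assume "i < dim_row (diagonal_of (n * p) (\<lambda>i. complex_of_real (d i)))"
      "j < dim_col (diagonal_of (n * p) (\<lambda>i. complex_of_real (d i)))"
    then have ij: "i < n * p" "j < n * p" by (auto simp: diagonal_of_def)
    then show "diag_blocks p (\<lambda>l. map_mat complex_of_real (\<Sigma> ! l)) $$ (i, j) =
        diagonal_of (n * p) (\<lambda>i. complex_of_real (d i)) $$ (i, j)"
      using \<Sigma>l(1)[OF block_div_less[OF ij(1)]] block_mod_less[OF ij(1)] block_mod_less[OF ij(2)] entry[OF ij]
      by (subst index_diag_blocks[of p "\<lambda>l. map_mat complex_of_real (\<Sigma> ! l)", OF C(1)]) (auto simp: diagonal_of_def)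
  qed (auto simp: diagonal_of_def)
  let ?X = "bcirc U * ?W" and ?Y = "bcirc V * ?W"
  have uU: "U \<in> tensors n n p" "unitary_mat (n * p) (bcirc U)"
    and uV: "V \<in> tensors n n p" "unitary_mat (n * p) (bcirc V)"
    using U V by (auto simp: t_unitary_iff[OF p])
  have X: "unitary_mat (n * p) ?X" and Y: "unitary_mat (n * p) ?Y"
    using uU uV unitary_block_dft by (auto intro: unitary_mat_mult)
  note c = unitary_matD(1)[OF uU(2)] unitary_matD(1)[OF uV(2)] block_dft_carrier[of p n]
  note TV = t_adjoint_tensors[OF uV(1) p]
  \<comment> \<open>Used with \<open>S\<close> for \<open>A\<close> and with the transformed factor
    for \<open>B\<close>, so that both matrices share the same \<open>?X\<close> and
    \<open>?Y\<close>.\<close>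
  have conj: "bcirc (U *\<^sub>T T *\<^sub>T t_adjoint V) = ?X * diag_block_mat Ds * mat_adjoint ?Y"
    if T: "T \<in> tensors n n p" and bT: "bcirc T = undo_dft n n Ds" and Ds: "length Ds = p"
      "diag_block_mat Ds \<in> carrier_mat (n * p) (n * p)" for T Ds
    using c Ds unfolding bcirc_t_prod[OF t_prod_tensors[OF uU(1) T p] TV p] bcirc_t_prod[OF uU(1) T p]
      bcirc_t_adjoint[OF uV(1) p] bT undo_dft_conjugation[OF Ds(1)]
    by (simp add: assoc_mult_mat[of _ "n * p" "n * p" _ "n * p" _ "n * p"]
        mult_carrier_mat[of _ "n * p" "n * p" _ "n * p"] mat_adjoint_mult[of _ "n * p" "n * p" _ "n * p"])
  have M: "bcirc A = ?X * diagonal_of (n * p) (\<lambda>i. complex_of_real (d i)) * mat_adjoint ?Y"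
    using conj[OF S bS] diag1 by (simp add: A_eq len)
  have norm: "norm2_mat (bcirc A) < R" using R by (simp add: t_norm2_def)
  have "0 < n * p" using n p by simp
  \<comment> \<open>The singular value with index 0 is nonnegative and at most the norm, so 0 lies
    inside the disc. There all terms vanish, since every exponent is at least 1.\<close>
  then have "0 < R"
    using singular_value_le_norm2[OF X Y _ d0 M, of 0] d0[of 0] norm by linarith
  then have f0: "f 0 = 0"
    using f[of 0] by (simp add: sums_iff)
  \<comment> \<open>At a zero singular value \<open>sv_fun\<close> gives 0 and the right-hand side
    gives \<open>f 0\<close>; they agree by \<open>f0\<close>.\<close>
  have diag2: "diag_block_mat (map (sv_fun f) \<Sigma>) =
      diagonal_of (n * p) (\<lambda>i. f (complex_of_real (d i)))"
    unfolding map\<Sigma> using diag_blocks_carrier[of p "\<lambda>l. sv_fun f (\<Sigma> ! l)", OF C(2)]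
  proof (intro eq_matI)
    fix i j assume "i < dim_row (diagonal_of (n * p) (\<lambda>i. f (complex_of_real (d i))))"
      "j < dim_col (diagonal_of (n * p) (\<lambda>i. f (complex_of_real (d i))))"
    then have ij: "i < n * p" "j < n * p" by (auto simp: diagonal_of_def)
    have m: "i mod n = j mod n \<longleftrightarrow> i = j" if "i div n = j div n"
      using that by (auto dest: block_index_eq)
    show "diag_blocks p (\<lambda>l. sv_fun f (\<Sigma> ! l)) $$ (i, j) =
        diagonal_of (n * p) (\<lambda>i. f (complex_of_real (d i))) $$ (i, j)"
      using ij \<Sigma>l(1)[OF block_div_less[OF ij(1)]] block_mod_less[OF ij(1)] block_mod_less[OF ij(2)]
        entry[OF ij] m d0[OF ij(1)] f0
      by (subst index_diag_blocks[of p "\<lambda>l. sv_fun f (\<Sigma> ! l)", OF C(2)])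
        (auto simp: diagonal_of_def sv_fun_def d_def)
  qed (auto simp: diagonal_of_def)
  let ?F = "F_diagonal_fun f n n \<Sigma>"
  have F: "?F \<in> tensors n n p" "bcirc ?F = undo_dft n n (map (sv_fun f) \<Sigma>)"
    using bcirc_bcirc_inv_undo_dft[of p "\<lambda>l. sv_fun f (\<Sigma> ! l)" n, OF C(2) p]
    by (auto simp: F_diagonal_fun_def len map\<Sigma>)
  show "B \<in> tensors n n p"
    unfolding B_def using t_prod_tensors[OF t_prod_tensors[OF uU(1) F(1) p] TV p] .
  have "bcirc B = ?X * diagonal_of (n * p) (\<lambda>i. f (complex_of_real (d i))) * mat_adjoint ?Y"
    unfolding B_def using conj[OF F] diag2 by (simp add: len)
  then show "(\<lambda>k. c (2 * k + 1) * odd_power (bcirc A) k $$ (i, j)) sums bcirc B $$ (i, j)"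
    if "i < n * p" "j < n * p" for i j
    using odd_power_series_sums[OF X Y d0 M f norm that] by simp
qed

section \<open>Doubly stochastic matrices and tensors\<close>

text \<open>Unlike in the classical notion, real entries may be negative, in accordance with doubly
  F-stochastic tensors.\<close>

definition doubly_stochastic_mat :: "nat \<Rightarrow> complex mat \<Rightarrow> bool" where
  "doubly_stochastic_mat n M \<longleftrightarrow> M \<in> carrier_mat n n \<and> (\<forall>i<n. \<forall>j<n. M $$ (i, j) \<in> \<real>) \<and>
     (\<forall>i<n. (\<Sum>j<n. M $$ (i, j)) = 1) \<and> (\<forall>j<n. (\<Sum>i<n. M $$ (i, j)) = 1)"

text \<open>Row sums of 1 mean that the all-ones vector is fixed from the right, column sums of 1
  that it is fixed from the left; products inherit both.\<close>

lemma doubly_stochastic_mat_mult: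
  assumes M: "doubly_stochastic_mat n M" and N: "doubly_stochastic_mat n N"
  shows "doubly_stochastic_mat n (M * N)"
proof -
  have c: "M \<in> carrier_mat n n" "N \<in> carrier_mat n n"
    using M N by (auto simp: doubly_stochastic_mat_def)
  note idx = index_mult_mat_sum[OF c]
  have row: "(\<Sum>j<n. (M * N) $$ (i, j)) = 1" if "i < n" for i
  proof -
    have "(\<Sum>j<n. (M * N) $$ (i, j)) = (\<Sum>j<n. \<Sum>l<n. M $$ (i, l) * N $$ (l, j))"
      using that by (intro sum.cong refl) (simp add: idx del: index_mult_mat)
    also have "\<dots> = (\<Sum>l<n. M $$ (i, l) * (\<Sum>j<n. N $$ (l, j)))"
      by (subst sum.swap) (simp add: sum_distrib_left)
    also have "\<dots> = 1" using M N that by (simp add: doubly_stochastic_mat_def)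
    finally show ?thesis .
  qed
  have col: "(\<Sum>i<n. (M * N) $$ (i, j)) = 1" if "j < n" for j
  proof -
    have "(\<Sum>i<n. (M * N) $$ (i, j)) = (\<Sum>i<n. \<Sum>l<n. M $$ (i, l) * N $$ (l, j))"
      using that by (intro sum.cong refl) (simp add: idx del: index_mult_mat)
    also have "\<dots> = (\<Sum>l<n. (\<Sum>i<n. M $$ (i, l)) * N $$ (l, j))"
      by (subst sum.swap) (simp add: sum_distrib_right)
    also have "\<dots> = 1" using M N that by (simp add: doubly_stochastic_mat_def)
    finally show ?thesis .
  qed
  have "(M * N) $$ (i, j) \<in> \<real>" if "i < n" "j < n" for i j
    using M N that by (auto simp: idx doubly_stochastic_mat_def intro!: sum_in_Reals simp del: index_mult_mat)
  with row col c show ?thesis by (simp add: doubly_stochastic_mat_def del: index_mult_mat)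
qed

text \<open>For real entries the adjoint is the transpose, which exchanges row and column
  sums.\<close>

lemma doubly_stochastic_mat_adjoint:
  assumes "doubly_stochastic_mat n M"
  shows "doubly_stochastic_mat n (mat_adjoint M)"
proof -
  have M: "M \<in> carrier_mat n n" using assms by (simp add: doubly_stochastic_mat_def)
  have "mat_adjoint M $$ (i, j) = M $$ (j, i)" if "i < n" "j < n" for i j
    using assms that M by (simp add: doubly_stochastic_mat_def Reals_cnj_iff)
  then show ?thesis using assms M by (simp add: doubly_stochastic_mat_def)
qed

lemma doubly_stochastic_odd_power:
  "doubly_stochastic_mat n M \<Longrightarrow> doubly_stochastic_mat n (odd_power M k)"
  by (induction k) (auto intro!: doubly_stochastic_mat_mult doubly_stochastic_mat_adjoint)

text \<open>The constant vector is fixed by \<open>M\<close>; the entry \<open>1 / sqrt n\<close>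
  makes it a unit vector.\<close>

lemma doubly_stochastic_norm2_ge_1:
  assumes M: "doubly_stochastic_mat n M" and n: "0 < n"
  shows "1 \<le> norm2_mat M"
proof -
  have c: "M \<in> carrier_mat n n" using M by (simp add: doubly_stochastic_mat_def)
  let ?a = "complex_of_real (1 / sqrt (real n))"
  let ?v = "vec n (\<lambda>_. ?a)"
  have v: "norm2_vec ?v = 1"
    using n by (intro norm2_vec_eqI) (simp_all add: scalar_prod_def flip: of_real_mult)
  have "M *\<^sub>v ?v = ?v"
  proof (intro eq_vecI)
    fix i assume "i < dim_vec ?v"
    then have i: "i < n" by simp
    have "(M *\<^sub>v ?v) $ i = (\<Sum>j<n. M $$ (i, j)) * ?a"
      using c i by (simp add: scalar_prod_def lessThan_atLeast0 sum_divide_distrib)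
    then show "(M *\<^sub>v ?v) $ i = ?v $ i" using M i by (simp add: doubly_stochastic_mat_def)
  qed (use c in auto)
  then show ?thesis using norm2_mat_upper[OF c, of ?v] v by simp
qed

text \<open>In term \<open>k\<close> every row and column sums to \<open>c k\<close>, and the finite
  sum may be taken before the limit, so the limit has sums \<open>\<Sum> c k = 1\<close>. Real
  coefficients keep the imaginary parts 0.\<close>

lemma doubly_stochastic_mat_sums:
  assumes O: "\<And>k. doubly_stochastic_mat n (O' k)" and B: "B \<in> carrier_mat n n"
    and sums: "\<And>i j. i < n \<Longrightarrow> j < n \<Longrightarrow> (\<lambda>k. c k * O' k $$ (i, j)) sums B $$ (i, j)"
    and c: "\<And>k. c k \<in> \<real>" and c1: "c sums 1"
  shows "doubly_stochastic_mat n B"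
proof -
  have "B $$ (i, j) \<in> \<real>" if "i < n" "j < n" for i j
  proof -
    have "Im (c k * O' k $$ (i, j)) = 0" for k
      using O[of k] c[of k] that by (simp add: doubly_stochastic_mat_def complex_is_Real_iff)
    then have "Im (B $$ (i, j)) = 0"
      using sums_Im[OF sums[OF that]] by (simp add: sums_iff)
    then show ?thesis by (simp add: complex_is_Real_iff)
  qed
  moreover have "(\<Sum>j<n. B $$ (i, j)) = 1" if "i < n" for i
  proof -
    have "(\<lambda>k. \<Sum>j<n. c k * O' k $$ (i, j)) sums (\<Sum>j<n. B $$ (i, j))"
      using sums that by (intro sums_sum) auto
    moreover have "(\<Sum>j<n. c k * O' k $$ (i, j)) = c k" for k
      using O[of k] that by (simp add: doubly_stochastic_mat_def flip: sum_distrib_left)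
    ultimately show ?thesis using c1 sums_unique2 by auto
  qed
  moreover have "(\<Sum>i<n. B $$ (i, j)) = 1" if "j < n" for j
  proof -
    have "(\<lambda>k. \<Sum>i<n. c k * O' k $$ (i, j)) sums (\<Sum>i<n. B $$ (i, j))"
      using sums that by (intro sums_sum) auto
    moreover have "(\<Sum>i<n. c k * O' k $$ (i, j)) = c k" for k
      using O[of k] that by (simp add: doubly_stochastic_mat_def flip: sum_distrib_left)
    ultimately show ?thesis using c1 sums_unique2 by auto
  qed
  ultimately show ?thesis using B by (simp add: doubly_stochastic_mat_def)
qed

text \<open>Unfolding the all-ones tensor gives the all-ones vector, so the product with it lists
  the row sums of \<open>bcirc A\<close>.\<close>

lemma t_prod_ones_iff:
  assumes A: "A \<in> tensors n n p" and p: "0 < p"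
  shows "A *\<^sub>T t_ones n p = t_ones n p \<longleftrightarrow> (\<forall>i<n * p. (\<Sum>j<n * p. bcirc A $$ (i, j)) = 1)"
proof -
  have ones: "t_ones n p \<in> tensors n 1 p" by (auto simp: t_ones_def tensors_def)
  note AO = t_prod_tensors[OF A ones p]
  have nth: "t_ones n p ! k $$ (r, 0) = 1" if "k < p" "r < n" for k r
    using that by (simp add: t_ones_def)
  have row: "(A *\<^sub>T t_ones n p) ! k $$ (r, 0) = (\<Sum>j<n * p. bcirc A $$ (k * n + r, j))"
    if "k < p" "r < n" for k r
    using that unfolding sum_blocks index_t_prod[OF A ones that less_one[THEN iffD2, OF refl]]
    by (intro sum.cong refl) (simp add: nth index_bcirc[OF A] block_index_less)
  have "A *\<^sub>T t_ones n p = t_ones n p \<longleftrightarrow> (\<forall>k<p. \<forall>r<n. (A *\<^sub>T t_ones n p) ! k $$ (r, 0) = 1)"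
    using nth by (auto intro!: tensors_eqI[OF AO ones])
  also have "\<dots> \<longleftrightarrow> (\<forall>k<p. \<forall>r<n. (\<Sum>j<n * p. bcirc A $$ (k * n + r, j)) = 1)"
    by (simp add: row)
  also have "\<dots> \<longleftrightarrow> (\<forall>i<n * p. (\<Sum>j<n * p. bcirc A $$ (i, j)) = 1)"
    by (metis block_index_less block_div_less block_mod_less div_mult_mod_eq)
  finally show ?thesis .
qed

text \<open>The second tensor equation becomes a condition on column sums because
  \<open>bcirc\<close> commutes with transposition. Reality transfers because \<open>bcirc A\<close>
  has the same entries as the slices, repeated.\<close>

lemma doubly_F_stochastic_iff:
  assumes p: "0 < p"
  shows "doubly_F_stochastic n p A \<longleftrightarrow> A \<in> tensors n n p \<and> doubly_stochastic_mat (n * p) (bcirc A)"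
proof (cases "A \<in> tensors n n p")
  case True
  note A = True and tr = t_transpose_tensors[OF True p] and c = bcirc_carrier[OF True p]
  have real: "real_tensor A \<longleftrightarrow> (\<forall>i<n * p. \<forall>j<n * p. bcirc A $$ (i, j) \<in> \<real>)"
  proof
    assume R: "real_tensor A"
    show "\<forall>i<n * p. \<forall>j<n * p. bcirc A $$ (i, j) \<in> \<real>"
    proof (intro allI impI)
      fix i j assume ij: "i < n * p" "j < n * p"
      have k: "cyclic_diff p (i div n) (j div n) < p" using p by simp
      then have "A ! cyclic_diff p (i div n) (j div n) \<in> set A" using tensorsD(1)[OF A] by simp
      then show "bcirc A $$ (i, j) \<in> \<real>"
        using R tensorsD(2)[OF A k] block_mod_less[OF ij(1)] block_mod_less[OF ij(2)]
        unfolding real_tensor_def index_bcirc[OF A ij] by (blast intro: elements_matI)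
    qed
  next
    assume R: "\<forall>i<n * p. \<forall>j<n * p. bcirc A $$ (i, j) \<in> \<real>"
    show "real_tensor A"
      unfolding real_tensor_def
    proof (intro ballI subsetI)
      fix M x assume "M \<in> set A" "x \<in> elements_mat M"
      then obtain k where k: "k < p" "M = A ! k"
        using tensorsD(1)[OF A] by (auto simp: in_set_conv_nth)
      then obtain r s where krs: "k < p" "r < n" "s < n" "x = A ! k $$ (r, s)"
        using elements_matD[OF \<open>x \<in> elements_mat M\<close>] tensorsD(2)[OF A k(1)] by auto
      have "n \<le> n * p" using p by simp
      then have "s < n * p" using krs(3) by (rule less_le_trans[rotated])
      then show "x \<in> \<real>" using R krs by (simp add: nth_index_bcirc[OF A] block_index_less)
    qed
  qed
  have "t_transpose A *\<^sub>T t_ones n p = t_ones n p \<longleftrightarrow> (\<forall>j<n * p. (\<Sum>i<n * p. bcirc A $$ (i, j)) = 1)"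
    unfolding t_prod_ones_iff[OF tr p] bcirc_t_transpose[OF A p] using c by auto
  then show ?thesis
    unfolding doubly_F_stochastic_def doubly_stochastic_mat_def t_prod_ones_iff[OF A p] real
    using A c by blast
qed (simp add: doubly_F_stochastic_def)

theorem theorem15:
  fixes A :: "complex tensor" and n p :: nat
    and c :: "nat \<Rightarrow> complex" and f g :: "complex \<Rightarrow> complex" and R :: real
  assumes "n \<ge> 1" and "p \<ge> 1"
    and "doubly_F_stochastic n p A"
    and "\<forall>\<^sub>F z in nhds 0. (\<lambda>k. c k * z ^ k) sums g z"
    and "\<And>z. cmod z < R \<Longrightarrow> (\<lambda>k. c (2 * k + 1) * z ^ (2 * k + 1)) sums f z"
    and "\<And>k. 0 \<le> c (2 * k + 1)"
    and "t_norm2 A < R"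
    and "f 1 = 1"
  shows "doubly_F_stochastic n p (gen_tensor_fun f A)"
proof -
  have n: "0 < n" and p: "0 < p" using assms(1,2) by auto
  have A: "A \<in> tensors n n p" and M: "doubly_stochastic_mat (n * p) (bcirc A)"
    using assms(3) doubly_F_stochastic_iff[OF p] by auto
  have dims: "nrows A = n" "ncols A = n" "length A = p"
    using tensors_dims[OF A p] tensorsD(1)[OF A] by auto
  note series = tsvd_fun_series_sums[OF A p n _ assms(5,7)]
  obtain U S \<Sigma> V where svd: "is_tsvd n n p A U S \<Sigma> V" using is_tsvd_exists[OF A p] by blast
  define B where "B = U *\<^sub>T F_diagonal_fun f n n \<Sigma> *\<^sub>T t_adjoint V"
  note B = series[OF svd, folded B_def]
  have "gen_tensor_fun f A = B"
    unfolding gen_tensor_fun_def dims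
  proof (rule the_equality)
    show "\<exists>U S \<Sigma> V. is_tsvd n n p A U S \<Sigma> V \<and> B = U *\<^sub>T F_diagonal_fun f n n \<Sigma> *\<^sub>T t_adjoint V"
      using svd B_def by blast
    fix B' assume "\<exists>U S \<Sigma> V. is_tsvd n n p A U S \<Sigma> V \<and> B' = U *\<^sub>T F_diagonal_fun f n n \<Sigma> *\<^sub>T t_adjoint V"
    then obtain U' S' \<Sigma>' V' where svd': "is_tsvd n n p A U' S' \<Sigma>' V'"
      and B'_def: "B' = U' *\<^sub>T F_diagonal_fun f n n \<Sigma>' *\<^sub>T t_adjoint V'" by blast
    note B' = series[OF svd', folded B'_def]
    have "bcirc B' = bcirc B"
      using bcirc_carrier[OF B(1) p] bcirc_carrier[OF B'(1) p] sums_unique2[OF B'(2) B(2)]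
      by (intro eq_matI) auto
    then show "B' = B" using inj_onD[OF inj_on_bcirc _ B'(1) B(1)] by blast
  qed
  moreover have "doubly_stochastic_mat (n * p) (bcirc B)"
  proof (rule doubly_stochastic_mat_sums[OF doubly_stochastic_odd_power[OF M]])
    \<comment> \<open>The order on the complex numbers demands equal imaginary parts, so
      \<open>0 \<le> c (2 * k + 1)\<close> includes that the coefficient is real.\<close>
    show "c (2 * k + 1) \<in> \<real>" for k
      using assms(6)[of k] by (simp add: complex_is_Real_iff less_eq_complex_def)
    have "1 < R"
      using doubly_stochastic_norm2_ge_1[OF M] n p assms(7) by (simp add: t_norm2_def)
    then show "(\<lambda>k. c (2 * k + 1)) sums 1"
      using assms(5)[of 1] assms(8) by simp
  qed (use bcirc_carrier[OF B(1) p] B(2) in auto)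
  ultimately show ?thesis using B(1) doubly_F_stochastic_iff[OF p] by simp
qed

end
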